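(* Let $n\ge 3$, $B_2\subset\mathbb R^n$, and let $k$ be an integer satisfying $\frac n2<k\le n$. Assume that $u\in C^2(B_2\setminus\{0\})$, $u>0$ and $\lambda(A^u)\in\overline\Gamma_k$ on $B_2\setminus\{0\}$. Then $\xi:=u^{-\frac{2}{n-2}}$ can be extended as a function in $C^{0,\alpha}(B_1)$, with $\alpha=\frac{2k-n}{k}\in(0,1]$, and $$\|\xi\|_{C^{0,\alpha}(B_{1/2})}\le C(n)\left[\min_{\partial B_1}u\right]^{-\frac{2}{n-2}} .$$ Consequently, either $$0<\inf_{B_1\setminus\{0\}}u\le\sup_{B_1\setminus\{0\}}u<\infty\quad\text{and}\quad u\in C^{0,\alpha}(B_1)$$ (that is, $u$ extends to such a function), or $$|x|^{\frac{n-2}{2}\alpha}u(x)\ge\frac{1}{C(n)}\left[\min_{\partial B_1}u\right],\qquad\forall\ 0<|x|<\frac12 .$$ Here $C(n)$ denotes a positive constant depending only on $n$.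
   Context: $B_a\subset\mathbb R^n$ is the ball of radius $a$ centered at the origin. $\sigma_k(\lambda)=\sum_{1\le i_1<\cdots<i_k\le n}\lambda_{i_1}\cdots\lambda_{i_k}$ is the $k$-th elementary symmetric function; $\Gamma_k$ is the connected component of $\{\lambda\in\mathbb R^n\mid\sigma_k(\lambda)>0\}$ containing the positive cone $\{\lambda\mid\lambda_i>0\ \forall i\}$, and $\overline\Gamma_k$ is its closure. $\lambda(M)$ denotes the eigenvalues of a symmetric matrix $M$. For a positive $C^2$ function $u$, $$A^u=-\frac{2}{n-2}u^{-\frac{n+2}{n-2}}\nabla^2u+\frac{2n}{(n-2)^2}u^{-\frac{2n}{n-2}}\nabla u\otimes\nabla u-\frac{2}{(n-2)^2}u^{-\frac{2n}{n-2}}|\nabla u|^2 I,$$ with $I$ the identity matrix. *)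

theory Defs
  imports "HOL-Analysis.Analysis"
begin

definition grad :: "(real ^ 'n \<Rightarrow> real) \<Rightarrow> real ^ 'n \<Rightarrow> real ^ 'n" where
  "grad f x = (\<chi> i. frechet_derivative f (at x) (axis i 1))"

definition hessian :: "(real ^ 'n \<Rightarrow> real) \<Rightarrow> real ^ 'n \<Rightarrow> real ^ 'n ^ 'n" where
  "hessian f x = jacobian (grad f) (at x)"

text \<open>Meant for open \<open>S\<close>, where it is the usual class \<open>C\<^sup>2(S)\<close>; differentiability is
  asked at the points of \<open>S\<close> with respect to a full neighbourhood.\<close>

definition C2_on :: "(real ^ 'n) set \<Rightarrow> (real ^ 'n \<Rightarrow> real) \<Rightarrow> bool" where
  "C2_on S f \<longleftrightarrow>
     (\<forall>x\<in>S. f differentiable (at x)) \<and>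
     (\<forall>x\<in>S. grad f differentiable (at x)) \<and>
     continuous_on S (hessian f)"

text \<open>The norm of \<open>C\<^bsup>0,\<alpha>\<^esup>(S)\<close> takes values in the extended nonnegative reals and is \<open>\<infinity>\<close>
  outside the space, so that the suprema are never taken of unbounded sets of reals. The space is
  the uniform one: bounded functions whose Hoelder quotient is bounded over all of \<open>S\<close>.\<close>

definition holder_norm :: "real \<Rightarrow> 'a::metric_space set \<Rightarrow> ('a \<Rightarrow> real) \<Rightarrow> ennreal" where
  "holder_norm \<alpha> S f =
     (SUP x\<in>S. ennreal \<bar>f x\<bar>) +
     (SUP x\<in>S. SUP y\<in>S - {x}. ennreal (\<bar>f x - f y\<bar> / dist x y powr \<alpha>))"

definition holder_space :: "real \<Rightarrow> 'a::metric_space set \<Rightarrow> ('a \<Rightarrow> real) set" where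
  "holder_space \<alpha> S = {f. holder_norm \<alpha> S f < \<infinity>}"

definition elem_sym :: "nat \<Rightarrow> real ^ 'n \<Rightarrow> real" where
  "elem_sym k l = (\<Sum>I | I \<subseteq> (UNIV :: 'n set) \<and> card I = k. \<Prod>i\<in>I. l $ i)"

text \<open>The component containing the positive cone is named by the point \<open>(1, \<dots>, 1)\<close> of that
  cone; see \<open>Gamma_cone_component\<close>.\<close>

definition Gamma_cone :: "nat \<Rightarrow> (real ^ 'n) set" where
  "Gamma_cone k = connected_component_set {l. elem_sym k l > 0} (\<chi> i. 1)"

lemma Gamma_cone_component:
  assumes "k \<le> CARD('n::finite)"
  shows "(Gamma_cone k :: (real ^ 'n) set) \<in> components {l. elem_sym k l > 0}"
    and "{l. \<forall>i. l $ i > 0} \<subseteq> (Gamma_cone k :: (real ^ 'n) set)"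
proof -
  let ?P = "{l :: real ^ 'n. \<forall>i. l $ i > 0}"
  obtain J :: "'n set" where J: "card J = k"
    using assms obtain_subset_with_card_n by blast
  have pos: "?P \<subseteq> {l. elem_sym k l > 0}"
  proof clarify
    fix l :: "real ^ 'n" assume "\<forall>i. l $ i > 0"
    then show "elem_sym k l > 0"
      unfolding elem_sym_def using J by (intro sum_pos) (auto intro: prod_pos)
  qed
  have "?P = (\<Inter>i. {l. axis i 1 \<bullet> l > 0})"
    by (auto simp: inner_axis')
  then have "convex ?P"
    by (simp add: convex_INT convex_halfspace_gt)
  then have conn: "connected ?P"
    by (rule convex_connected)
  have one: "(\<chi> i. 1) \<in> ?P"
    by simp
  show "?P \<subseteq> Gamma_cone k"
    unfolding Gamma_cone_def by (rule connected_component_maximal[OF one conn pos])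
  show "(Gamma_cone k :: (real ^ 'n) set) \<in> components {l. elem_sym k l > 0}"
    unfolding Gamma_cone_def using one pos by (intro componentsI) blast
qed

text \<open>\<open>l\<close> lists the eigenvalues of \<open>M\<close> with multiplicity, in some order. A symmetric \<open>M\<close> has such
  an \<open>l\<close>, unique up to permutation of the coordinates, and \<open>Gamma_cone k\<close> is invariant under such
  permutations, so that membership of \<open>\<lambda>(M)\<close> in its closure does not depend on the order.\<close>

definition eigenvalue_vector :: "real ^ 'n ^ 'n \<Rightarrow> real ^ 'n \<Rightarrow> bool" where
  "eigenvalue_vector M l \<longleftrightarrow> (\<forall>t. det (mat t - M) = (\<Prod>i\<in>UNIV. t - l $ i))"

definition conformal_hessian :: "(real ^ 'n \<Rightarrow> real) \<Rightarrow> real ^ 'n \<Rightarrow> real ^ 'n ^ 'n" where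
  "conformal_hessian u x =
     (let n = real CARD('n); g = grad u x in
       (- (2 / (n - 2)) * u x powr (- (n + 2) / (n - 2))) *\<^sub>R hessian u x
       + (2 * n / (n - 2)\<^sup>2 * u x powr (- (2 * n) / (n - 2))) *\<^sub>R (\<chi> i j. g $ i * g $ j)
       - (2 / (n - 2)\<^sup>2 * u x powr (- (2 * n) / (n - 2)) * (norm g)\<^sup>2) *\<^sub>R mat 1)"

end

theory Submission
  imports Defs "HOL-Computational_Algebra.Fundamental_Theorem_Algebra"
begin

text \<open>In terms of \<open>\<xi> = u\<^bsup>-2/(n-2)\<^esup>\<close> the conformal metric \<open>u\<^bsup>4/(n-2)\<^esup> |dx|\<^sup>2\<close> is \<open>\<xi>\<^bsup>-2\<^esup> |dx|\<^sup>2\<close>, and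
  \<open>A\<^sup>u = \<xi> \<nabla>\<^sup>2\<xi> - |\<nabla>\<xi>|\<^sup>2 I / 2\<close>. Radial solutions of \<open>\<sigma>\<^sub>k(\<lambda>(A\<^sup>u)) = 0\<close> around a point \<open>x\<^sub>0\<close> are
  \<open>\<xi>\<^bsup>\<alpha>/2\<^esup> = a + b |x - x\<^sub>0|\<^bsup>\<alpha>\<^esup>\<close> with \<open>\<alpha> = 2 - n/k\<close>, and \<open>\<alpha>\<close> is positive just because \<open>k > n/2\<close>. These solutions
  are finite at their centre, so they can serve as upper barriers for \<open>w = \<xi>\<^bsup>\<alpha>/2\<^esup> = u\<^bsup>-\<theta>\<^esup>\<close> that start
  from the value \<open>w(x\<^sub>0)\<close> itself. The comparison \<open>w(x) \<le> w(x\<^sub>0) + C |x - x\<^sub>0|\<^bsup>\<alpha>\<^esup>\<close>, with \<open>x\<close> and \<open>x\<^sub>0\<close> in both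
  roles, is the Hoelder estimate, and the rest of the theorem follows from it by distinguishing
  whether \<open>\<xi>\<close> tends to \<open>0\<close> at the puncture.

  Three points carry the proof. The first is algebraic. All that is used of the cone is the
  pinching inequality \<open>\<lambda>\<^bsub>min\<^esub> + c \<lambda>\<^bsub>max\<^esub> \<ge> 0\<close> with \<open>c = (n - k) / k = 1 - \<alpha>\<close>
  (\<open>closure_Gamma_cone_pinching\<close>). The \<open>\<sigma>\<^sub>j(\<lambda>)\<close> with \<open>j \<le> k\<close> are, up to positive factors, the
  coefficients of the derivative of order \<open>n - k\<close> of \<open>\<Prod> (t + \<lambda>\<^sub>i)\<close>. This polynomial is real-rooted;
  that confines the component \<open>\<Gamma>\<^sub>k\<close> to the set where these \<open>\<sigma>\<^sub>j\<close> are positive, and on the closure no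
  root is positive, while differentiation cannot move the largest root \<open>- \<lambda>\<^bsub>min\<^esub>\<close> down too far. For a
  symmetric matrix the inequality only involves one direction \<open>e\<close> and an upper bound of the
  quadratic form, so it applies to a test function that touches a power of \<open>u\<close> (\<open>touching\<close>).

  The second is a minimum principle across the puncture (\<open>affine_minimum_principle\<close>). It is
  formulated for \<open>1 / w = u\<^bsup>\<theta>\<^esup>\<close>, which is positive, so that a barrier tending to \<open>-\<infinity>\<close> at the origin
  stays below it without prior information on the singularity.

  The third is the comparison in the presence of the puncture (\<open>radial_comparison\<close>). The barriers
  are made strict by an exponent \<open>\<beta> < \<alpha>\<close>, and strictness survives small linear perturbations. Hence,
  if \<open>w\<close> exceeded a barrier \<open>h\<close>, no small linear perturbation of \<open>w - h\<close> could attain a maximum away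
  from the origin, and \<open>w\<close> would stay below \<open>h\<close> plus a constant with a gap \<open>\<epsilon> |x|\<close>, attained in the
  limit at the origin only. The minimum principle, applied to \<open>1 / w\<close> on a small ball, excludes such
  a corner.\<close>

section \<open>Real-rooted polynomials and their derivatives\<close>

definition root_poly :: "'a::comm_ring_1 list \<Rightarrow> 'a poly" where
  "root_poly rs = (\<Prod>r\<leftarrow>rs. [:-r, 1:])"

lemma root_poly_simps [simp]:
  "root_poly [] = 1"
  "root_poly (r # rs) = [:-r, 1:] * root_poly rs"
  by (simp_all add: root_poly_def)

lemma root_poly_neq_0 [simp]: "root_poly (rs :: 'a::idom list) \<noteq> 0"
  by (induction rs) (simp_all del: mult_pCons_left)

lemma degree_root_poly [simp]: "degree (root_poly (rs :: 'a::idom list)) = length rs"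
  by (induction rs) (auto simp: degree_mult_eq simp del: mult_pCons_left)

lemma lead_coeff_root_poly: "coeff (root_poly (rs :: 'a::idom list)) (length rs) = 1"
proof -
  have "lead_coeff (root_poly rs) = 1"
    by (induction rs) (simp_all add: lead_coeff_mult del: mult_pCons_left)
  then show ?thesis by simp
qed

lemma poly_root_poly_eq_0: "poly (root_poly (rs :: 'a::idom list)) x = 0 \<longleftrightarrow> x \<in> set rs"
  by (induction rs) (simp_all del: mult_pCons_left)

lemma log_derivative_root_poly:
  fixes x :: "'a::{field,idom}"
  assumes "x \<notin> set rs"
  shows "poly (pderiv (root_poly rs)) x = poly (root_poly rs) x * (\<Sum>r\<leftarrow>rs. 1 / (x - r))"
  using assms
proof (induction rs)
  case (Cons a rs)
  have "poly (pderiv (root_poly (a # rs))) x =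
      (x - a) * poly (pderiv (root_poly rs)) x + poly (root_poly rs) x"
    by (simp add: pderiv_mult pderiv_pCons del: mult_pCons_left)
  moreover have "(x - a) * (1 / (x - a) + s) = 1 + (x - a) * s" for s
    using Cons.prems by (simp add: distrib_left)
  then have "(x - a) * p * (1 / (x - a) + s) = (x - a) * (p * s) + p" for p s
    by (metis (no_types, lifting) add.commute distrib_left mult.commute mult.left_commute mult.right_neutral)
  ultimately show ?case
    using Cons by (simp del: mult_pCons_left)
qed simp

lemma map_poly_of_real_mult:
  "map_poly of_real (p * q) = (map_poly of_real p * map_poly of_real q :: complex poly)"
  by (rule poly_eqI) (simp add: coeff_map_poly coeff_mult)

lemma map_poly_of_real_pderiv:
  "map_poly of_real (pderiv p) = (pderiv (map_poly of_real p) :: complex poly)"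
  by (rule poly_eqI) (simp add: coeff_map_poly coeff_pderiv)

lemma map_poly_of_real_root_poly:
  "map_poly of_real (root_poly rs) = (root_poly (map of_real rs) :: complex poly)"
  by (induction rs)
    (simp_all add: map_poly_of_real_mult map_poly_pCons del: mult_pCons_left)

lemma poly_map_poly_of_real:
  "poly (map_poly of_real p) (of_real x) = (of_real (poly p x) :: complex)"
  by (induction p) (simp_all add: map_poly_pCons)

lemma real_rooted_imp_root_poly:
  fixes q :: "real poly"
  assumes "q \<noteq> 0" and "\<And>z :: complex. poly (map_poly of_real q) z = 0 \<Longrightarrow> Im z = 0"
  shows "\<exists>rs. q = smult (lead_coeff q) (root_poly rs)"
  using assms
proof (induction "degree q" arbitrary: q)
  case 0
  then obtain c where "q = [:c:]"
    by (metis degree_eq_zeroE)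
  then show ?case by (intro exI[of _ "[]"]) simp
next
  case (Suc d)
  have "degree (map_poly of_real q :: complex poly) = Suc d"
    using Suc.hyps by (simp add: degree_map_poly)
  then have "\<not> constant (poly (map_poly of_real q :: complex poly))"
    by (simp add: constant_degree)
  then obtain z :: complex where z: "poly (map_poly of_real q) z = 0"
    using fundamental_theorem_of_algebra by blast
  then have "z = of_real (Re z)"
    using Suc.prems(2) by (simp add: complex_eq_iff)
  then have "poly q (Re z) = 0"
    using z poly_map_poly_of_real[of q "Re z"] by (metis of_real_eq_0_iff)
  then obtain q' where q': "q = [:-Re z, 1:] * q'"
    by (metis dvd_def poly_eq_0_iff_dvd)
  have "q' \<noteq> 0" using q' Suc.prems(1) by auto
  have "degree q = Suc (degree q')"
    unfolding q' using \<open>q' \<noteq> 0\<close> by (subst degree_mult_eq) auto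
  then have "\<exists>rs. q' = smult (lead_coeff q') (root_poly rs)"
  proof (intro Suc.hyps(1) \<open>q' \<noteq> 0\<close>)
    fix w :: complex assume "poly (map_poly of_real q') w = 0"
    then show "Im w = 0"
      using Suc.prems(2)[of w] unfolding q' by (simp add: map_poly_of_real_mult del: mult_pCons_left)
  qed (use Suc.hyps in simp)
  then obtain rs where rs: "q' = smult (lead_coeff q') (root_poly rs)" by blast
  have lc: "lead_coeff q = lead_coeff q'"
    unfolding q' by (subst lead_coeff_mult) simp
  show ?case
  proof (rule exI[of _ "Re z # rs"])
    show "q = smult (lead_coeff q) (root_poly (Re z # rs))"
      unfolding lc root_poly_simps(2) mult_smult_right[symmetric] rs[symmetric] by (rule q')
  qed
qed

text \<open>The half-plane form of the Gauss--Lucas argument keeps all roots real: at a non-real \<open>z\<close> all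
  terms of the logarithmic derivative \<open>\<Sum> 1 / (z - r)\<close> have imaginary part of the sign opposite to
  \<open>Im z\<close>, so their sum cannot vanish.\<close>

lemma pderiv_root_poly:
  assumes "rs \<noteq> []"
  shows "\<exists>rs'. length rs = Suc (length rs') \<and>
    pderiv (root_poly rs) = smult (real (length rs)) (root_poly rs')"
proof -
  let ?q = "pderiv (root_poly rs)"
  have deg: "degree ?q = length rs - 1"
    by (simp add: degree_pderiv)
  have lc: "lead_coeff ?q = real (length rs)"
    using assms lead_coeff_root_poly[of rs] unfolding deg
    by (simp add: coeff_pderiv)
  have "\<exists>rs'. ?q = smult (lead_coeff ?q) (root_poly rs')"
  proof (rule real_rooted_imp_root_poly)
    show "?q \<noteq> 0"
      using lc assms by auto
  next
    fix z :: complex assume z: "poly (map_poly of_real ?q) z = 0"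
    show "Im z = 0"
    proof (rule ccontr)
      assume im: "Im z \<noteq> 0"
      let ?rs = "map complex_of_real rs"
      have notin: "z \<notin> set ?rs"
        using im by auto
      have "0 = poly (root_poly ?rs) z * (\<Sum>r\<leftarrow>?rs. 1 / (z - r))"
        using z by (simp add: map_poly_of_real_pderiv map_poly_of_real_root_poly
            log_derivative_root_poly[OF notin])
      then have "(\<Sum>r\<leftarrow>?rs. 1 / (z - r)) = 0"
        using notin poly_root_poly_eq_0[of ?rs z] by simp
      moreover have "Im z * Im (\<Sum>r\<leftarrow>?rs. 1 / (z - r)) < 0"
        using assms
      proof (induction rs rule: list_nonempty_induct)
        case (single r)
        have "0 < (Re z - r)\<^sup>2 + (Im z)\<^sup>2"
          using im by (simp add: sum_power2_gt_zero_iff)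
        moreover have "0 < Im z * Im z"
          using im by (auto simp: zero_less_mult_iff neq_iff)
        ultimately show ?case
          by (simp add: Im_divide divide_simps power2_eq_square)
      next
        case (cons r rs)
        have "0 < (Re z - r)\<^sup>2 + (Im z)\<^sup>2"
          using im by (simp add: sum_power2_gt_zero_iff)
        moreover have "0 < Im z * Im z"
          using im by (auto simp: zero_less_mult_iff neq_iff)
        ultimately have "Im z * Im (1 / (z - complex_of_real r)) < 0"
          by (simp add: Im_divide divide_simps power2_eq_square)
        then show ?case using cons.IH by (simp add: distrib_left)
      qed
      ultimately show False by simp
    qed
  qed
  then obtain rs' where rs': "?q = smult (lead_coeff ?q) (root_poly rs')" by blast
  have "length rs - 1 = length rs'"
    using arg_cong[OF rs', of degree] deg lc assms by simp
  then show ?thesis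
    using rs' lc assms by (intro exI[of _ rs']) (cases rs, auto)
qed

text \<open>How far the largest root can drop under one differentiation when all roots stay above \<open>a\<close>. Let
  \<open>b\<close> be the largest root and suppose it is simple. By Rolle there is a critical point \<open>b'\<close> between \<open>b\<close>
  and the next root, and there \<open>1 / (b - b') = \<Sum> 1 / (b' - r)\<close> over the remaining roots \<open>r\<close>. Each of
  these terms is at least \<open>1 / (b' - a)\<close>, which bounds \<open>b'\<close> from below. Equality holds for
  \<open>(t - a)\<^bsup>n-1\<^esup> (t - b)\<close>.\<close>

lemma pderiv_root_poly_bounds:
  assumes pd: "pderiv (root_poly rs) = smult c (root_poly rs')"
    and c: "c \<noteq> 0" and len: "length rs = Suc (length rs')" "rs' \<noteq> []"
    and a: "\<And>r. r \<in> set rs \<Longrightarrow> a \<le> r" and B: "\<exists>b\<in>set rs. B \<le> b"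
  shows "\<And>r. r \<in> set rs' \<Longrightarrow> a \<le> r"
    and "\<exists>b'\<in>set rs'. real (length rs') * (B - a) \<le> real (length rs) * (b' - a)"
proof -
  have root: "r \<in> set rs' \<longleftrightarrow> poly (pderiv (root_poly rs)) r = 0" for r
    unfolding pd using c by (simp add: poly_root_poly_eq_0)
  show "a \<le> r" if "r \<in> set rs'" for r
  proof (rule ccontr)
    assume "\<not> a \<le> r"
    then have notin: "r \<notin> set rs" and neg: "\<And>s. s \<in> set rs \<Longrightarrow> r < s"
      using a by force+
    have "(\<Sum>s\<leftarrow>rs. 1 / (r - s)) < 0"
    proof -
      have "rs \<noteq> []" using len by auto
      then show ?thesis using neg
        by (induction rs rule: list_nonempty_induct) (auto simp: field_simps add_neg_neg)
    qed
    moreover have "(\<Sum>s\<leftarrow>rs. 1 / (r - s)) = 0"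
      using that root[of r] notin by (simp add: log_derivative_root_poly poly_root_poly_eq_0)
    ultimately show False by simp
  qed
  define b where "b = Max (set rs)"
  have "rs \<noteq> []" using len by auto
  then have b: "b \<in> set rs" "\<And>r. r \<in> set rs \<Longrightarrow> r \<le> b" "B \<le> b"
    using B unfolding b_def by (auto simp: Max_ge_iff)
  define us where "us = remove1 b rs"
  have us: "length us = length rs'" "set us \<subseteq> set rs" "mset rs = add_mset b (mset us)"
    using b(1) len by (auto simp: us_def length_remove1 set_remove1_subset)
  have fac: "root_poly rs = [:-b, 1:] * root_poly us"
  proof -
    have "root_poly rs = (\<Prod>r\<in>#mset rs. [:-r, 1:])"
      by (simp add: root_poly_def flip: prod_mset_prod_list mset_map)
    also have "\<dots> = [:-b, 1:] * root_poly us"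
      by (simp add: us(3) root_poly_def flip: prod_mset_prod_list mset_map del: mult_pCons_left)
    finally show ?thesis .
  qed
  have pderiv_at: "poly (pderiv (root_poly rs)) x =
      (x - b) * poly (pderiv (root_poly us)) x + poly (root_poly us) x" for x
    unfolding fac by (simp add: pderiv_mult pderiv_pCons del: mult_pCons_left)
  have len': "real (length rs) = real (length rs') + 1" using len by simp
  have "\<exists>b'\<in>set rs'. real (length rs') * (b - a) \<le> real (length rs) * (b' - a)"
  proof (cases "b \<in> set us")
    case True
    then have "b \<in> set rs'"
      unfolding root pderiv_at by (simp add: poly_root_poly_eq_0)
    then show ?thesis
      using a[OF b(1)] len' by (intro bexI[of _ b]) (auto intro!: mult_right_mono)
  next
    case False
    define b2 where "b2 = Max (set us)"
    have "us \<noteq> []" using us(1) len by auto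
    then have b2: "b2 \<in> set us" "\<And>r. r \<in> set us \<Longrightarrow> r \<le> b2"
      unfolding b2_def by auto
    have "b2 < b"
      using b2(1) b(2)[of b2] us(2) False by (metis less_eq_real_def subsetD)
    have "poly (root_poly rs) b2 = 0" "poly (root_poly rs) b = 0"
      using b2(1) b(1) us(2) by (auto simp: poly_root_poly_eq_0)
    then obtain b' where b': "b2 < b'" "b' < b" "poly (pderiv (root_poly rs)) b' = 0"
      using poly_MVT[OF \<open>b2 < b\<close>, of "root_poly rs"] \<open>b2 < b\<close> by auto
    have notin: "b' \<notin> set us" using b2(2) b'(1) by force
    have gt: "a \<le> r \<and> r < b'" if "r \<in> set us" for r
      using a[of r] us(2) b2(2)[OF that] b'(1) that by auto
    have "a < b'" using gt[OF b2(1)] by simp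
    have "poly (root_poly us) b' * ((b' - b) * (\<Sum>r\<leftarrow>us. 1 / (b' - r)) + 1) = 0"
      using b'(3) unfolding pderiv_at log_derivative_root_poly[OF notin] by (simp add: algebra_simps)
    then have "(b' - b) * (\<Sum>r\<leftarrow>us. 1 / (b' - r)) + 1 = 0"
      using notin poly_root_poly_eq_0[of us b'] by simp
    then have eq: "(b - b') * (\<Sum>r\<leftarrow>us. 1 / (b' - r)) = 1"
      by (simp add: left_diff_distrib)
    have "real (length rs') / (b' - a) = (\<Sum>r\<leftarrow>us. 1 / (b' - a))"
      using us(1) by (simp add: sum_list_triv)
    also have "\<dots> \<le> (\<Sum>r\<leftarrow>us. 1 / (b' - r))"
      using gt \<open>a < b'\<close> by (intro sum_list_mono) (auto intro!: divide_left_mono mult_pos_pos)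
    finally have "(b - b') * (real (length rs') / (b' - a)) \<le> 1"
      using eq b'(2) by (smt (verit) mult_left_mono)
    then have "(b - b') * real (length rs') \<le> b' - a"
      using \<open>a < b'\<close> by (simp add: field_simps)
    then have "real (length rs') * (b - a) \<le> real (length rs) * (b' - a)"
      unfolding len' by (simp add: algebra_simps)
    then show ?thesis using b'(3) root by blast
  qed
  then obtain b' where "b' \<in> set rs'" "real (length rs') * (b - a) \<le> real (length rs) * (b' - a)"
    by blast
  moreover have "real (length rs') * (B - a) \<le> real (length rs') * (b - a)"
    using b(3) by (intro mult_left_mono) auto
  ultimately show "\<exists>b'\<in>set rs'. real (length rs') * (B - a) \<le> real (length rs) * (b' - a)"
    by force
qed

text \<open>The bound of the previous lemma telescopes: after several differentiations the distance of
  the largest root from \<open>a\<close> has shrunk at most by the quotient of the two degrees.\<close>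

definition roots_spread :: "real list \<Rightarrow> real list \<Rightarrow> bool" where
  "roots_spread rs rs' \<longleftrightarrow>
    (\<forall>a B. (\<forall>r\<in>set rs. a \<le> r) \<longrightarrow> (\<exists>b\<in>set rs. B \<le> b) \<longrightarrow>
       (\<forall>r\<in>set rs'. a \<le> r) \<and>
       (\<exists>b'\<in>set rs'. real (length rs') * (B - a) \<le> real (length rs) * (b' - a)))"

lemma higher_pderiv_root_poly:
  assumes "j < length rs"
  shows "\<exists>c rs'. 0 < c \<and> length rs' = length rs - j \<and>
    (pderiv ^^ j) (root_poly rs) = smult c (root_poly rs') \<and>
    roots_spread rs rs'"
  using assms
proof (induction j)
  case 0
  show ?case
    by (rule exI[of _ 1], rule exI[of _ rs]) (auto simp: roots_spread_def intro!: mult_left_mono)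
next
  case (Suc j)
  then obtain c rs' where IH: "0 < c" "length rs' = length rs - j"
      "(pderiv ^^ j) (root_poly rs) = smult c (root_poly rs')"
      "roots_spread rs rs'"
    by auto
  have "rs' \<noteq> []" using IH(2) Suc.prems by auto
  then obtain rs'' where rs'': "length rs' = Suc (length rs'')"
      "pderiv (root_poly rs') = smult (real (length rs')) (root_poly rs'')"
    using pderiv_root_poly by blast
  have ne: "rs'' \<noteq> []" using IH(2) Suc.prems rs''(1) by auto
  show ?case
    unfolding roots_spread_def
  proof (intro exI[of _ "c * real (length rs')"] exI[of _ rs''] conjI allI impI)
    show "0 < c * real (length rs')" using IH(1) rs''(1) by simp
    show "length rs'' = length rs - Suc j" using IH(2) rs''(1) by simp
    show "(pderiv ^^ Suc j) (root_poly rs) = smult (c * real (length rs')) (root_poly rs'')"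
      by (simp add: IH(3) pderiv_smult rs''(2))
    fix a B assume ass: "\<forall>r\<in>set rs. a \<le> r" "\<exists>b\<in>set rs. B \<le> b"
    obtain b where b: "b \<in> set rs'" "real (length rs') * (B - a) \<le> real (length rs) * (b - a)"
      using IH(4) ass unfolding roots_spread_def by blast
    have a': "\<And>r. r \<in> set rs' \<Longrightarrow> a \<le> r"
      using IH(4) ass unfolding roots_spread_def by blast
    have lpos: "real (length rs') \<noteq> 0" using rs''(1) by simp
    have 1: "\<exists>b0\<in>set rs'. b \<le> b0" using b(1) by blast
    show "\<forall>r\<in>set rs''. a \<le> r"
      using pderiv_root_poly_bounds(1)[OF rs''(2) lpos rs''(1) ne a' 1] by blast
    obtain b' where b': "b' \<in> set rs''"
        "real (length rs'') * (b - a) \<le> real (length rs') * (b' - a)"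
      using pderiv_root_poly_bounds(2)[OF rs''(2) lpos rs''(1) ne a' 1] by blast
    have "real (length rs') * (real (length rs'') * (B - a)) \<le> real (length rs) * (real (length rs'') * (b - a))"
      using mult_left_mono[OF b(2), of "real (length rs'')"] by (simp add: algebra_simps)
    also have "\<dots> \<le> real (length rs) * (real (length rs') * (b' - a))"
      using b'(2) by (intro mult_left_mono) auto
    finally have "real (length rs') * (real (length rs'') * (B - a)) \<le> real (length rs') * (real (length rs) * (b' - a))"
      by (simp add: algebra_simps)
    then have "real (length rs'') * (B - a) \<le> real (length rs) * (b' - a)"
      using rs''(1) by (subst (asm) mult_le_cancel_left_pos) auto
    then show "\<exists>b'\<in>set rs''. real (length rs'') * (B - a) \<le> real (length rs) * (b' - a)"
      using b'(1) by blast
  qed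
qed

lemma coeff_root_poly_pos:
  fixes rs :: "real list"
  assumes "\<And>r. r \<in> set rs \<Longrightarrow> r < 0" and "i \<le> length rs"
  shows "0 < coeff (root_poly rs) i"
  using assms
proof (induction rs arbitrary: i)
  case (Cons r rs)
  have "0 < - r * coeff (root_poly rs) i \<or> i = Suc (length rs)"
    using Cons by (cases "i \<le> length rs") (auto simp: mult_neg_pos)
  moreover have "coeff (root_poly rs) i = 0" if "i = Suc (length rs)"
    using that by (intro coeff_eq_0) simp
  moreover have "0 < (case i of 0 \<Rightarrow> 0 | Suc j \<Rightarrow> coeff (root_poly rs) j)" if "i > 0"
    using Cons.IH[of "i - 1"] Cons.prems that by (cases i) auto
  moreover have "coeff (root_poly (r # rs)) i =
      - r * coeff (root_poly rs) i + (case i of 0 \<Rightarrow> 0 | Suc j \<Rightarrow> coeff (root_poly rs) j)"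
    by (cases i) (simp_all)
  ultimately show ?case by (cases i) (auto simp: add_pos_pos)
qed simp

section \<open>Pinching on the closure of the cone\<close>

lemma coeff_prod_linear:
  fixes l :: "'i \<Rightarrow> real"
  assumes "finite A" "j \<le> card A"
  shows "coeff (\<Prod>i\<in>A. [:l i, 1:]) (card A - j) = (\<Sum>I | I \<subseteq> A \<and> card I = j. \<Prod>i\<in>I. l i)"
proof -
  have "(\<Prod>i\<in>A. [:l i, 1:]) = (\<Prod>i\<in>A. [:l i:] + monom 1 1)"
    by (intro prod.cong) (auto simp: monom_altdef)
  also have "\<dots> = (\<Sum>I\<in>Pow A. (\<Prod>i\<in>I. [:l i:]) * (\<Prod>i\<in>A - I. monom 1 1))"
    by (rule prod_add[OF assms(1)])
  also have "\<dots> = (\<Sum>I\<in>Pow A. monom (\<Prod>i\<in>I. l i) (card A - card I))"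
  proof (intro sum.cong refl)
    fix I assume "I \<in> Pow A"
    then have "finite I"
      using assms(1) by (auto intro: finite_subset)
    then have I: "card (A - I) = card A - card I"
      using \<open>I \<in> Pow A\<close> by (simp add: card_Diff_subset)
    have "(\<Prod>i\<in>I. [:l i:]) = [:\<Prod>i\<in>I. l i:]"
      by (induction I rule: infinite_finite_induct) (auto simp: one_pCons)
    then show "(\<Prod>i\<in>I. [:l i:]) * (\<Prod>i\<in>A - I. monom 1 1) = monom (\<Prod>i\<in>I. l i) (card A - card I)"
      by (simp add: I monom_power smult_monom)
  qed
  finally have "coeff (\<Prod>i\<in>A. [:l i, 1:]) (card A - j) =
      (\<Sum>I\<in>Pow A. if card A - card I = card A - j then \<Prod>i\<in>I. l i else 0)"
    by (simp add: coeff_sum)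
  also have "\<dots> = (\<Sum>I\<in>Pow A. if card I = j then \<Prod>i\<in>I. l i else 0)"
  proof (intro sum.cong refl)
    fix I assume "I \<in> Pow A"
    then have "card I \<le> card A" using assms(1) by (auto intro: card_mono)
    then have "card A - card I = card A - j \<longleftrightarrow> card I = j"
      using assms(2) by linarith
    then show "(if card A - card I = card A - j then \<Prod>i\<in>I. l i else 0) =
        (if card I = j then \<Prod>i\<in>I. l i else 0)" by simp
  qed
  also have "\<dots> = (\<Sum>I | I \<in> Pow A \<and> card I = j. \<Prod>i\<in>I. l i)"
    using assms(1) by (intro sum.inter_filter[symmetric]) simp
  finally show ?thesis by (simp only: Pow_iff)
qed

lemma elem_sym_as_coefficients:
  fixes l :: "real ^ 'n::finite"
  shows "\<exists>rs. length rs = CARD('n) \<and> set rs = range (\<lambda>i. - l $ i) \<and>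
    (\<forall>j\<le>CARD('n). coeff (root_poly rs) (CARD('n) - j) = elem_sym j l)"
proof -
  obtain xs :: "'n list" where xs: "set xs = UNIV" "distinct xs"
    using finite_distinct_list[OF finite] by blast
  let ?rs = "map (\<lambda>i. - l $ i) xs"
  have "root_poly ?rs = (\<Prod>i\<in>UNIV. [:l $ i, 1:])"
    using xs prod.distinct_set_conv_list[OF xs(2), of "\<lambda>i. [:l $ i, 1:]"]
    by (simp add: root_poly_def o_def)
  then have "\<forall>j\<le>CARD('n). coeff (root_poly ?rs) (CARD('n) - j) = elem_sym j l"
    using coeff_prod_linear[of "UNIV :: 'n set" _ "\<lambda>i. l $ i"] by (simp add: elem_sym_def)
  moreover have "length ?rs = CARD('n)"
    using xs distinct_card by fastforce
  ultimately show ?thesis using xs(1) by (intro exI[of _ ?rs]) auto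
qed

text \<open>The polynomial \<open>q\<close> is the derivative of order \<open>n - k\<close> of \<open>\<Prod> (t + l\<^sub>i)\<close>. It is the bridge between
  cone and roots: up to positive factors its coefficients are the \<open>\<sigma>\<^sub>j\<close> with \<open>j \<le> k\<close>, and its largest
  root is controlled by the extreme entries of \<open>l\<close>.\<close>

lemma derivative_with_elem_sym_coefficients:
  fixes l :: "real ^ 'n::finite"
  assumes "1 \<le> k" "k \<le> CARD('n)"
  obtains q c rs d where "q = smult c (root_poly rs)" "0 < c" "length rs = k"
    "\<forall>j\<le>k. 0 < (d j :: real)"
    "\<forall>j\<le>k. coeff q (k - j) = d j * elem_sym j l"
    "\<forall>i T. (\<forall>j. l $ j \<le> T) \<longrightarrow>
        (\<exists>b\<in>set rs. real k * (T - l $ i) \<le> real CARD('n) * (b + T))"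
proof -
  let ?n = "CARD('n)"
  obtain us where us: "length us = ?n" "set us = range (\<lambda>i. - l $ i)"
      "\<forall>j\<le>?n. coeff (root_poly us) (?n - j) = elem_sym j l"
    using elem_sym_as_coefficients[of l] by blast
  have "?n - k < length us" using assms us(1) by simp
  from higher_pderiv_root_poly[OF this] obtain c rs where
    rs: "0 < c" "length rs = length us - (?n - k)"
      "(pderiv ^^ (?n - k)) (root_poly us) = smult c (root_poly rs)"
      and sp: "roots_spread us rs"
    by blast
  have len: "length rs = k" using rs(2) us(1) assms by simp
  define d where "d j = (pochhammer (real (Suc (k - j))) (?n - k))" for j
  show ?thesis
  proof (rule that[of "smult c (root_poly rs)" c rs d]; (intro allI impI)?)
    fix j assume j: "j \<le> k"
    show "0 < d j" unfolding d_def by (intro pochhammer_pos) auto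
  next
    fix j assume j: "j \<le> k"
    have "k - j + (?n - k) = ?n - j" using j assms by simp
    moreover have "coeff (smult c (root_poly rs)) (k - j) =
       d j * coeff (root_poly us) (k - j + (?n - k))"
      unfolding rs(3)[symmetric] coeff_higher_pderiv d_def by simp
    ultimately show "coeff (smult c (root_poly rs)) (k - j) = d j * elem_sym j l"
      using us(3) j assms by simp
  next
    fix i T assume T: "\<forall>j. l $ j \<le> T"
    have "\<forall>r\<in>set us. - T \<le> r" "\<exists>b\<in>set us. - l $ i \<le> b"
      using T us(2) by auto
    then have "\<exists>b'\<in>set rs. real (length rs) * (- l $ i - (- T)) \<le> real (length us) * (b' - (- T))"
      using sp unfolding roots_spread_def by blast
    then show "\<exists>b\<in>set rs. real k * (T - l $ i) \<le> real ?n * (b + T)"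
      by (simp add: len us(1) add.commute)
  qed (use rs len in auto)
qed

lemma poly_pos_of_nonneg_coeffs:
  fixes q :: "real poly"
  assumes "\<And>i. 0 \<le> coeff q i" "q \<noteq> 0" "0 < x"
  shows "0 < poly q x"
proof -
  have "0 < lead_coeff q"
    using assms(1)[of "degree q"] assms(2) by (simp add: order_less_le)
  then show ?thesis
    unfolding poly_altdef using assms(1,3)
    by (intro sum_pos2[of _ "degree q"]) (auto intro!: mult_pos_pos mult_nonneg_nonneg)
qed

lemma poly_pos_of_nonneg_coeffs_at_0:
  fixes q :: "real poly"
  assumes "\<And>i. 0 \<le> coeff q i" "0 < coeff q 0" "0 \<le> x"
  shows "0 < poly q x"
  unfolding poly_altdef using assms
  by (intro sum_pos2[of _ 0]) (auto intro!: mult_nonneg_nonneg)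

text \<open>Nonnegative coefficients and a positive constant term leave no room for nonnegative roots;
  since all roots are real, they are all negative, and then no coefficient can vanish.\<close>

lemma elem_sym_pos_of_nonneg:
  fixes l :: "real ^ 'n::finite"
  assumes "1 \<le> k" "k \<le> CARD('n)" and nn: "\<And>j. j < k \<Longrightarrow> 0 \<le> elem_sym j l" and pos: "0 < elem_sym k l"
    and "j \<le> k"
  shows "0 < elem_sym j l"
proof -
  obtain q c rs d where q: "q = smult c (root_poly rs)" "0 < c" "length rs = k"
    and dpos: "\<forall>j\<le>k. 0 < (d j :: real)"
    and d: "\<forall>j\<le>k. coeff q (k - j) = d j * elem_sym j l"
    and bd: "\<forall>i T. (\<forall>j. l $ j \<le> T) \<longrightarrow>
        (\<exists>b\<in>set rs. real k * (T - l $ i) \<le> real CARD('n) * (b + T))"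
    by (rule derivative_with_elem_sym_coefficients[OF assms(1,2), of l]) (rule that)
  have cf: "0 \<le> coeff q i" for i
  proof (cases "i \<le> k")
    case True
    then have "coeff q i = d (k - i) * elem_sym (k - i) l" "0 < d (k - i)"
      using d[rule_format, of "k - i"] dpos[rule_format, of "k - i"] by auto
    then show ?thesis using nn[of "k - i"] pos True by (cases "i = 0") auto
  next
    case False
    then show ?thesis using q by (simp add: coeff_eq_0)
  qed
  have "0 < coeff q 0" using d[rule_format, of k] dpos[rule_format, of k] pos by simp
  have "r < 0" if "r \<in> set rs" for r
  proof (rule ccontr)
    assume "\<not> r < 0"
    then have "0 < poly q r"
      by (intro poly_pos_of_nonneg_coeffs_at_0 cf \<open>0 < coeff q 0\<close>) simp
    then show False using that by (simp add: q(1) poly_root_poly_eq_0[THEN iffD2])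
  qed
  then have "0 < coeff q (k - j)"
    unfolding q(1) using coeff_root_poly_pos[of rs "k - j"] q(2,3) by simp
  then show ?thesis using d[rule_format, OF \<open>j \<le> k\<close>] dpos[rule_format, OF \<open>j \<le> k\<close>]
    by (simp add: zero_less_mult_iff)
qed

lemma continuous_on_elem_sym: "continuous_on A (elem_sym k :: real ^ 'n::finite \<Rightarrow> real)"
  unfolding elem_sym_def by (intro continuous_intros)

text \<open>By the previous lemma \<open>{\<sigma>\<^sub>k > 0}\<close> is the disjoint union of the open sets where all lower \<open>\<sigma>\<^sub>j\<close> are
  positive and where some lower \<open>\<sigma>\<^sub>j\<close> is negative. A connected set meeting the first one stays in it.\<close>

lemma Gamma_cone_elem_sym_pos:
  assumes "1 \<le> k" "k \<le> CARD('n::finite)" "l \<in> (Gamma_cone k :: (real ^ 'n) set)" "j \<le> k"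
  shows "0 < elem_sym j l"
proof -
  let ?H = "\<Inter>j\<in>{..k}. {l :: real ^ 'n. 0 < elem_sym j l}"
  let ?N = "\<Union>j\<in>{..<k}. {l :: real ^ 'n. elem_sym j l < 0}"
  let ?one = "(\<chi> i. 1) :: real ^ 'n"
  have sub: "Gamma_cone k \<subseteq> {l :: real ^ 'n. 0 < elem_sym k l}"
    unfolding Gamma_cone_def by (rule connected_component_subset)
  have one: "?one \<in> Gamma_cone k" "\<And>j. j \<le> k \<Longrightarrow> 0 < elem_sym j ?one"
    using Gamma_cone_component(2)[where 'n='n] assms(2)
  proof -
    show "0 < elem_sym j ?one" if "j \<le> k" for j
    proof -
      have "j \<le> CARD('n)" using that assms(2) by simp
      then have "?one \<in> Gamma_cone j"
        using Gamma_cone_component(2)[where 'n='n and k=j] by (simp add: subset_eq)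
      then show ?thesis
        using connected_component_subset[of "{l :: real ^ 'n. 0 < elem_sym j l}" ?one]
        unfolding Gamma_cone_def by blast
    qed
  qed (auto simp: subset_eq assms)
  have "connected (Gamma_cone k :: (real ^ 'n) set)"
    unfolding Gamma_cone_def by (rule connected_connected_component)
  moreover have "open ?H" "open ?N"
    by (auto intro!: open_INT open_UN open_Collect_less continuous_on_elem_sym continuous_on_const)
  moreover have "Gamma_cone k \<subseteq> ?H \<union> ?N"
  proof
    fix l :: "real ^ 'n" assume "l \<in> Gamma_cone k"
    then have "0 < elem_sym k l" using sub by blast
    show "l \<in> ?H \<union> ?N"
    proof (cases "\<exists>j<k. elem_sym j l < 0")
      case True
      then show ?thesis by auto
    next
      case False
      then have "0 \<le> elem_sym j l" if "j < k" for j
        using that by (meson not_less)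
      then have "0 < elem_sym j l" if "j \<le> k" for j
        using elem_sym_pos_of_nonneg[OF assms(1,2) _ \<open>0 < elem_sym k l\<close> that] by blast
      then show ?thesis by auto
    qed
  qed
  moreover have "?H \<inter> ?N \<inter> Gamma_cone k = {}"
  proof -
    have "l \<notin> ?N" if "l \<in> ?H" for l :: "real ^ 'n"
      using that by (auto simp: not_less intro!: less_imp_le)
    then show ?thesis by blast
  qed
  moreover have "?H \<inter> Gamma_cone k \<noteq> {}" using one by auto
  ultimately have "?N \<inter> Gamma_cone k = {}"
    using connectedD[of "Gamma_cone k" ?H ?N] by blast
  then have "l \<in> ?H" using assms(3) \<open>Gamma_cone k \<subseteq> ?H \<union> ?N\<close> by blast
  then show ?thesis using assms(4) by blast
qed

text \<open>The only property of the cone that the analysis uses: a negative entry forces a comparable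
  positive one. On the closed cone the polynomial \<open>q\<close> has nonnegative coefficients, hence no
  positive root; but its largest root lies above \<open>- T\<close> by at least \<open>k / n\<close> times \<open>T - l\<^sub>i\<close>. The constant
  is attained at \<open>(T, \<dots>, T, l\<^sub>i)\<close> with \<open>\<sigma>\<^sub>k = 0\<close>.\<close>

lemma closure_Gamma_cone_pinching:
  fixes l :: "real ^ 'n::finite"
  assumes k: "1 \<le> k" "k \<le> CARD('n)" and l: "l \<in> closure (Gamma_cone k)" and T: "\<And>j. l $ j \<le> T"
  shows "0 \<le> l $ i + (real CARD('n) - real k) / real k * T"
proof -
  have nn: "0 \<le> elem_sym j l" if "j \<le> k" for j
  proof -
    have "closed {l :: real ^ 'n. 0 \<le> elem_sym j l}"
      by (intro closed_Collect_le continuous_on_elem_sym continuous_on_const)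
    moreover have "Gamma_cone k \<subseteq> {l :: real ^ 'n. 0 \<le> elem_sym j l}"
      using Gamma_cone_elem_sym_pos[OF k _ that] by (auto intro: less_imp_le)
    ultimately show ?thesis using l closure_minimal by blast
  qed
  obtain q c rs d where q: "q = smult c (root_poly rs)" "0 < c" "length rs = k"
    and dpos: "\<forall>j\<le>k. 0 < (d j :: real)"
    and d: "\<forall>j\<le>k. coeff q (k - j) = d j * elem_sym j l"
    and bd: "\<forall>i T. (\<forall>j. l $ j \<le> T) \<longrightarrow>
        (\<exists>b\<in>set rs. real k * (T - l $ i) \<le> real CARD('n) * (b + T))"
    by (rule derivative_with_elem_sym_coefficients[OF k, of l]) (rule that)
  have cf: "0 \<le> coeff q i" for i
  proof (cases "i \<le> k")
    case True
    then have "coeff q i = d (k - i) * elem_sym (k - i) l" "0 < d (k - i)"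
      using d[rule_format, of "k - i"] dpos[rule_format, of "k - i"] by auto
    then show ?thesis using nn[of "k - i"] by auto
  next
    case False
    then show ?thesis using q by (simp add: coeff_eq_0)
  qed
  obtain b where b: "b \<in> set rs" "real k * (T - l $ i) \<le> real CARD('n) * (b + T)"
    using bd T by blast
  have "q \<noteq> 0" using q by simp
  have "b \<le> 0"
  proof (rule ccontr)
    assume "\<not> b \<le> 0"
    then have "0 < poly q b"
      by (intro poly_pos_of_nonneg_coeffs cf \<open>q \<noteq> 0\<close>) simp
    then show False using b(1) by (simp add: q(1) poly_root_poly_eq_0[THEN iffD2])
  qed
  then have "real CARD('n) * (b + T) \<le> real CARD('n) * T"
    by (intro mult_left_mono) auto
  then have "real k * (T - l $ i) \<le> real CARD('n) * T" using b(2) by linarith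
  then show ?thesis using k(1) by (simp add: field_simps)
qed

section \<open>Pinching for symmetric matrices\<close>

lemma det_eq_0_imp_kernel:
  fixes A :: "real ^ 'n ^ 'n::finite"
  assumes "det A = 0"
  obtains v where "v \<noteq> 0" "A *v v = 0"
proof -
  have "\<not> invertible A" using assms by (simp add: invertible_det_nz)
  then have "\<not> (\<exists>B. B ** A = mat 1)" by (simp add: invertible_left_inverse)
  then show ?thesis using that unfolding matrix_left_invertible_ker by blast
qed

lemma mat_minus_mult_vec:
  fixes M :: "real ^ 'n ^ 'n::finite"
  shows "(mat t - M) *v v = t *\<^sub>R v - M *v v"
proof -
  have "mat t *v v = t *\<^sub>R v"
    by (simp add: vec_eq_iff matrix_vector_mult_def mat_def if_distrib[of "\<lambda>x. x * _"] cong: if_cong)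
  then show ?thesis by (simp add: matrix_vector_mult_diff_rdistrib)
qed

text \<open>The pinching of the eigenvalues, read off from the quadratic form alone. An upper bound of
  the form bounds all eigenvalues from above; and since \<open>M\<close> is symmetric, the minimum of the form
  over the unit sphere is an eigenvalue, so that any single direction \<open>e\<close> bounds the least
  eigenvalue.\<close>

lemma rayleigh_pinching:
  fixes M :: "real ^ 'n ^ 'n::finite"
  assumes k: "1 \<le> k" "k \<le> CARD('n)"
    and sym: "\<And>v w. v \<bullet> (M *v w) = w \<bullet> (M *v v)"
    and ev: "eigenvalue_vector M l" "l \<in> closure (Gamma_cone k)"
    and L: "\<And>v. norm v = 1 \<Longrightarrow> v \<bullet> (M *v v) \<le> L"
    and e: "norm e = 1"
  shows "0 \<le> e \<bullet> (M *v e) + (real CARD('n) - real k) / real k * L"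
proof -
  let ?Q = "\<lambda>v. v \<bullet> (M *v v)"
  have eig: "det (mat t - M) = 0 \<longleftrightarrow> (\<exists>i. t = l $ i)" for t
    using ev(1) by (auto simp: eigenvalue_vector_def)
  have le: "l $ i \<le> L" for i
  proof -
    have "det (mat (l $ i) - M) = 0" unfolding eig by blast
    then obtain v where v: "v \<noteq> 0" "(mat (l $ i) - M) *v v = 0"
      by (rule det_eq_0_imp_kernel)
    let ?w = "v /\<^sub>R norm v"
    have "M *v v = l $ i *\<^sub>R v" using v(2) by (simp add: mat_minus_mult_vec)
    then have "M *v ?w = l $ i *\<^sub>R ?w"
      by (simp add: matrix_vector_mult_scaleR)
    then have "?Q ?w = l $ i * (norm ?w)\<^sup>2"
      by (simp only: inner_scaleR_right power2_norm_eq_inner)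
    moreover have "norm ?w = 1" using v(1) by simp
    ultimately show ?thesis using L[of ?w] by simp
  qed
  have "compact (sphere 0 1 :: (real ^ 'n) set)" by simp
  moreover have "sphere 0 1 \<noteq> ({} :: (real ^ 'n) set)" using e by auto
  moreover have "continuous_on (sphere 0 1) ?Q"
    by (intro continuous_intros matrix_vector_mult_linear_continuous_on)
  ultimately obtain v0 where v0: "norm v0 = 1" "\<And>v. norm v = 1 \<Longrightarrow> ?Q v0 \<le> ?Q v"
    using continuous_attains_inf[of "sphere 0 1" ?Q] by auto
  let ?m = "?Q v0"
  have Qge: "?m * (norm v)\<^sup>2 \<le> ?Q v" for v
  proof (cases "v = 0")
    case False
    let ?w = "v /\<^sub>R norm v"
    have "norm ?w = 1" using False by simp
    then have "?m \<le> ?Q ?w" by (rule v0(2))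
    also have "?Q ?w = ?Q v / (norm v)\<^sup>2"
      by (simp add: matrix_vector_mult_scaleR power2_eq_square field_simps)
    finally show ?thesis using False by (simp add: field_simps)
  qed simp
  let ?r = "M *v v0 - ?m *\<^sub>R v0"
  have "w \<bullet> ?r = 0" for w
  proof -
    let ?A = "?Q w - ?m * (norm w)\<^sup>2" and ?B = "w \<bullet> ?r"
    have quad: "0 \<le> 2 * t * ?B + t\<^sup>2 * ?A" for t
    proof -
      have "?Q (v0 + t *\<^sub>R w) = ?m + 2 * t * (w \<bullet> (M *v v0)) + t\<^sup>2 * ?Q w"
        using sym[of v0 w]
        by (simp add: matrix_vector_right_distrib matrix_vector_mult_scaleR inner_add_left
            inner_add_right power2_eq_square algebra_simps)
      moreover have "(norm (v0 + t *\<^sub>R w))\<^sup>2 = 1 + 2 * t * (w \<bullet> v0) + t\<^sup>2 * (norm w)\<^sup>2"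
      proof -
        have "v0 \<bullet> v0 = 1" using v0(1) by (metis norm_eq_1)
        then show ?thesis
          unfolding power2_norm_eq_inner
          by (simp add: inner_add_left inner_add_right inner_commute power2_eq_square algebra_simps)
      qed
      ultimately show ?thesis
        using Qge[of "v0 + t *\<^sub>R w"] by (simp add: inner_diff_right algebra_simps)
    qed
    show ?thesis
    proof (rule ccontr)
      assume B: "?B \<noteq> 0"
      \<comment> \<open>A quadratic polynomial without constant term that has a nonzero linear term takes negative
        values; \<open>- s * ?B\<close> is a point close enough to the origin to exhibit one.\<close>
      define s where "s = 1 / (\<bar>?A\<bar> + 1)"
      have s: "0 < s" "s * ?A < 2"
      proof -
        show "0 < s" by (simp add: s_def)
        have "s * ?A \<le> s * \<bar>?A\<bar>" using \<open>0 < s\<close> by (intro mult_left_mono) auto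
        also have "\<dots> < 2" by (simp add: s_def field_simps)
        finally show "s * ?A < 2" .
      qed
      have "0 \<le> 2 * (- (s * ?B)) * ?B + (- (s * ?B))\<^sup>2 * ?A" by (rule quad)
      also have "\<dots> = s * ?B\<^sup>2 * (s * ?A - 2)" by (simp add: power2_eq_square algebra_simps)
      also have "\<dots> < 0" using B s by (intro mult_pos_neg) auto
      finally show False by simp
    qed
  qed
  then have "?r = 0" by (metis inner_eq_zero_iff)
  then have "(mat ?m - M) *v v0 = 0" by (simp add: mat_minus_mult_vec)
  moreover have "v0 \<noteq> 0" using v0(1) by auto
  ultimately have "det (mat ?m - M) = 0"
    by (metis invertible_det_nz invertible_left_inverse matrix_left_invertible_ker)
  then obtain i where i: "?m = l $ i" unfolding eig by blast
  have "0 \<le> l $ i + (real CARD('n) - real k) / real k * L"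
    by (rule closure_Gamma_cone_pinching[OF k ev(2) le])
  then show ?thesis using v0(2)[OF e] i by linarith
qed

section \<open>Second derivatives along lines\<close>

text \<open>Functions of several variables are compared only along lines \<open>t \<mapsto> y + t v\<close>, so that a calculus
  of second-order jets at \<open>0\<close> of functions of one variable suffices. The first derivative is asked
  for in a neighbourhood, so that minima can be tested with the second one.\<close>

definition jet2 :: "(real \<Rightarrow> real) \<Rightarrow> real \<Rightarrow> real \<Rightarrow> bool" where
  "jet2 \<phi> a b \<longleftrightarrow> (\<exists>\<phi>'. (\<forall>\<^sub>F t in nhds 0. (\<phi> has_real_derivative \<phi>' t) (at t)) \<and>
     \<phi>' 0 = a \<and> (\<phi>' has_real_derivative b) (at 0))"

lemma jet2_affine: "jet2 (\<lambda>t. p + t * a) a 0"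
  unfolding jet2_def
  by (intro exI[of _ "\<lambda>_. a"]) (auto intro!: derivative_eq_intros always_eventually)

lemma jet2_add:
  assumes "jet2 f a b" "jet2 g a' b'"
  shows "jet2 (\<lambda>t. f t + g t) (a + a') (b + b')"
proof -
  from assms obtain f' g' where *:
    "\<forall>\<^sub>F t in nhds 0. (f has_real_derivative f' t) (at t)" "f' 0 = a" "(f' has_real_derivative b) (at 0)"
    "\<forall>\<^sub>F t in nhds 0. (g has_real_derivative g' t) (at t)" "g' 0 = a'" "(g' has_real_derivative b') (at 0)"
    unfolding jet2_def by auto
  have "\<forall>\<^sub>F t in nhds 0. ((\<lambda>t. f t + g t) has_real_derivative f' t + g' t) (at t)"
    using *(1,4) by eventually_elim (rule DERIV_add)
  then show ?thesis
    unfolding jet2_def using * by (intro exI[of _ "\<lambda>t. f' t + g' t"]) (auto intro: DERIV_add)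
qed

lemma jet2_cmult:
  assumes "jet2 f a b"
  shows "jet2 (\<lambda>t. c * f t) (c * a) (c * b)"
proof -
  from assms obtain f' where *:
    "\<forall>\<^sub>F t in nhds 0. (f has_real_derivative f' t) (at t)" "f' 0 = a" "(f' has_real_derivative b) (at 0)"
    unfolding jet2_def by auto
  have "\<forall>\<^sub>F t in nhds 0. ((\<lambda>t. c * f t) has_real_derivative c * f' t) (at t)"
    using *(1) by eventually_elim (rule DERIV_cmult)
  then show ?thesis
    unfolding jet2_def using * by (intro exI[of _ "\<lambda>t. c * f' t"]) (auto intro: DERIV_cmult)
qed

lemma jet2_diff:
  assumes "jet2 f a b" "jet2 g a' b'"
  shows "jet2 (\<lambda>t. f t - g t) (a - a') (b - b')"
  using jet2_add[OF assms(1) jet2_cmult[OF assms(2), of "-1"]] by simp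

lemma jet2_compose:
  assumes "jet2 \<phi> a b"
    and F: "\<forall>\<^sub>F s in nhds (\<phi> 0). (F has_real_derivative F' s) (at s)"
    and F': "(F' has_real_derivative d) (at (\<phi> 0))"
  shows "jet2 (\<lambda>t. F (\<phi> t)) (F' (\<phi> 0) * a) (d * a\<^sup>2 + F' (\<phi> 0) * b)"
proof -
  from assms(1) obtain \<phi>' where *:
    "\<forall>\<^sub>F t in nhds 0. (\<phi> has_real_derivative \<phi>' t) (at t)" "\<phi>' 0 = a" "(\<phi>' has_real_derivative b) (at 0)"
    unfolding jet2_def by auto
  have d0: "(\<phi> has_real_derivative a) (at 0)"
    using eventually_nhds_x_imp_x[OF *(1)] *(2) by simp
  then have "isCont \<phi> 0" by (rule DERIV_isCont)
  then have "filterlim \<phi> (nhds (\<phi> 0)) (nhds 0)"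
    by (simp add: isCont_def tendsto_nhds_iff)
  then have "\<forall>\<^sub>F t in nhds 0. (F has_real_derivative F' (\<phi> t)) (at (\<phi> t))"
    using eventually_compose_filterlim[OF F] by blast
  with *(1) have "\<forall>\<^sub>F t in nhds 0. ((\<lambda>t. F (\<phi> t)) has_real_derivative F' (\<phi> t) * \<phi>' t) (at t)"
    by eventually_elim (rule DERIV_chain2)
  moreover have "((\<lambda>t. F' (\<phi> t) * \<phi>' t) has_real_derivative d * a\<^sup>2 + F' (\<phi> 0) * b) (at 0)"
    using DERIV_mult[OF DERIV_chain2[OF F' d0] *(3)] *(2)
    by (simp add: power2_eq_square algebra_simps)
  ultimately show ?thesis
    unfolding jet2_def using *(2) by (intro exI[of _ "\<lambda>t. F' (\<phi> t) * \<phi>' t"]) auto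
qed

lemma jet2_powr:
  assumes "jet2 \<phi> a b" "0 < \<phi> 0"
  shows "jet2 (\<lambda>t. \<phi> t powr p) (p * \<phi> 0 powr (p - 1) * a)
    (p * (p - 1) * \<phi> 0 powr (p - 2) * a\<^sup>2 + p * \<phi> 0 powr (p - 1) * b)"
proof (rule jet2_compose[OF assms(1), where F = "\<lambda>s. s powr p" and F' = "\<lambda>s. p * s powr (p - 1)"])
  have "\<forall>\<^sub>F s in nhds (\<phi> 0). s \<in> {0<..}"
    using assms(2) by (intro eventually_nhds_in_open) auto
  then show "\<forall>\<^sub>F s in nhds (\<phi> 0). ((\<lambda>s. s powr p) has_real_derivative p * s powr (p - 1)) (at s)"
    by eventually_elim (auto intro: has_real_derivative_powr)
  show "((\<lambda>s. p * s powr (p - 1)) has_real_derivative p * (p - 1) * \<phi> 0 powr (p - 2)) (at (\<phi> 0))"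
    using DERIV_cmult[OF has_real_derivative_powr[OF assms(2), of "p - 1"], of p]
    by (simp add: mult.assoc)
qed

lemma jet2_local_min:
  assumes "jet2 \<phi> a b" "\<forall>\<^sub>F t in nhds 0. \<phi> 0 \<le> \<phi> t"
  shows "a = 0" "0 \<le> b"
proof -
  from assms(1) obtain \<phi>' where *:
    "\<forall>\<^sub>F t in nhds 0. (\<phi> has_real_derivative \<phi>' t) (at t)" "\<phi>' 0 = a" "(\<phi>' has_real_derivative b) (at 0)"
    unfolding jet2_def by auto
  obtain d where d: "0 < d" "\<And>t. \<bar>t\<bar> < d \<Longrightarrow> \<phi> 0 \<le> \<phi> t \<and> (\<phi> has_real_derivative \<phi>' t) (at t)"
    using eventually_conj[OF assms(2) *(1)] by (auto simp: eventually_nhds_metric)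
  show "a = 0"
    using d *(2) by (intro DERIV_local_min[of \<phi> a 0 d]) auto
  show "0 \<le> b"
  proof (rule ccontr)
    assume "\<not> 0 \<le> b"
    then obtain d' where d': "0 < d'" "\<And>h. 0 < h \<Longrightarrow> h < d' \<Longrightarrow> \<phi>' h < \<phi>' 0"
      using DERIV_neg_dec_right[OF *(3)] by auto
    define h where "h = min d d' / 2"
    have h: "0 < h" "h < d" "h < d'" using d(1) d'(1) by (auto simp: h_def min_def)
    obtain x where x: "0 < x" "x < h" "\<phi> h - \<phi> 0 = (h - 0) * \<phi>' x"
      using MVT2[OF h(1), of \<phi> \<phi>'] d(2) h(2) by auto
    have "\<phi>' x < 0" using d'(2)[of x] x h *(2) \<open>a = 0\<close> by auto
    then have "\<phi> h < \<phi> 0" using x(3) h(1) by (smt (verit) mult_pos_neg diff_zero)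
    moreover have "\<phi> 0 \<le> \<phi> h" using d(2)[of h] h by auto
    ultimately show False by simp
  qed
qed

lemma has_derivative_line:
  assumes "(f has_derivative f') (at (z + t *\<^sub>R v))"
  shows "((\<lambda>t. f (z + t *\<^sub>R v)) has_derivative (\<lambda>h. f' (h *\<^sub>R v))) (at t)"
proof -
  have "((\<lambda>t. z + t *\<^sub>R v) has_derivative (\<lambda>h. h *\<^sub>R v)) (at t)"
    by (auto intro!: derivative_eq_intros)
  from has_derivative_compose[OF this, of f f'] show ?thesis using assms by simp
qed

text \<open>One half of the classical proof that second derivatives are symmetric: the second difference
  is evaluated by the mean value theorem in direction \<open>v\<close> and by differentiability of the gradient
  at the single point \<open>y\<close>. The second difference is symmetric in \<open>v\<close> and \<open>w\<close>, the limit is not visibly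
  so.\<close>

lemma second_difference_quotient:
  fixes u :: "'a::real_inner \<Rightarrow> real"
  assumes u: "\<forall>\<^sub>F x in nhds y. (u has_derivative (\<lambda>h. g x \<bullet> h)) (at x)"
    and g: "(g has_derivative L) (at y)" and "0 < \<epsilon>"
  shows "\<exists>\<delta>>0. \<forall>t. 0 < t \<longrightarrow> t < \<delta> \<longrightarrow>
    \<bar>u (y + t *\<^sub>R v + t *\<^sub>R w) - u (y + t *\<^sub>R v) - u (y + t *\<^sub>R w) + u y - t\<^sup>2 * (L w \<bullet> v)\<bar> \<le> t\<^sup>2 * \<epsilon>"
proof -
  have lin: "linear L" using g by (rule has_derivative_linear)
  define K where "K = norm v + norm w + 1"
  have K: "0 < K" "norm v \<le> K" "norm v + norm w \<le> K" unfolding K_def using norm_ge_zero[of v] norm_ge_zero[of w] by linarith+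
  define e where "e = \<epsilon> / (2 * K * K)"
  have e: "0 < e" using \<open>0 < \<epsilon>\<close> K by (simp add: e_def)
  obtain d1 where d1: "0 < d1" "\<And>x. dist x y < d1 \<Longrightarrow> (u has_derivative (\<lambda>h. g x \<bullet> h)) (at x)"
    using u by (auto simp: eventually_nhds_metric)
  obtain d2 where d2: "0 < d2"
      "\<And>x. norm (x - y) < d2 \<Longrightarrow> norm (g x - g y - L (x - y)) \<le> e * norm (x - y)"
    using g e unfolding has_derivative_at_alt by blast
  show ?thesis
  proof (intro exI[of _ "min d1 d2 / K"] conjI allI impI)
    show "0 < min d1 d2 / K" using d1 d2 K by simp
    fix t :: real assume t: "0 < t" "t < min d1 d2 / K"
    then have tK: "t * K < d1" "t * K < d2" using K by (auto simp: field_simps)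
    have small: "norm (s *\<^sub>R v + r *\<^sub>R w) \<le> t * K" if "0 \<le> s" "s \<le> t" "0 \<le> r" "r \<le> t" for s r
    proof -
      have "norm (s *\<^sub>R v + r *\<^sub>R w) \<le> s * norm v + r * norm w"
        using that norm_triangle_ineq[of "s *\<^sub>R v" "r *\<^sub>R w"] by simp
      also have "\<dots> \<le> t * norm v + t * norm w" using that by (intro add_mono mult_right_mono) auto
      also have "\<dots> \<le> t * K" using t K(3) by (simp flip: distrib_left)
      finally show ?thesis .
    qed
    define \<phi> where "\<phi> s = u (y + s *\<^sub>R v + t *\<^sub>R w) - u (y + s *\<^sub>R v)" for s
    have der: "(\<phi> has_real_derivative (g (y + s *\<^sub>R v + t *\<^sub>R w) - g (y + s *\<^sub>R v)) \<bullet> v) (at s)"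
      if "0 \<le> s" "s \<le> t" for s
    proof -
      have A: "(u has_derivative (\<lambda>h. g (y + s *\<^sub>R v + t *\<^sub>R w) \<bullet> h)) (at (y + s *\<^sub>R v + t *\<^sub>R w))"
        using small[of s t] that t tK by (intro d1(2)) (auto simp: dist_norm add.assoc)
      have B: "(u has_derivative (\<lambda>h. g (y + s *\<^sub>R v) \<bullet> h)) (at (y + s *\<^sub>R v))"
        using small[of s 0] that t tK by (intro d1(2)) (auto simp: dist_norm)
      have "((\<lambda>s. u (y + s *\<^sub>R v + t *\<^sub>R w)) has_derivative (\<lambda>h. g (y + s *\<^sub>R v + t *\<^sub>R w) \<bullet> (h *\<^sub>R v))) (at s)"
        using has_derivative_line[of u "\<lambda>h. g (y + s *\<^sub>R v + t *\<^sub>R w) \<bullet> h" "y + t *\<^sub>R w" s v] A by (simp add: add_ac)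
      moreover have "((\<lambda>s. u (y + s *\<^sub>R v)) has_derivative (\<lambda>h. g (y + s *\<^sub>R v) \<bullet> (h *\<^sub>R v))) (at s)"
        by (rule has_derivative_line[OF B])
      ultimately have "(\<phi> has_derivative (\<lambda>h. g (y + s *\<^sub>R v + t *\<^sub>R w) \<bullet> (h *\<^sub>R v) - g (y + s *\<^sub>R v) \<bullet> (h *\<^sub>R v))) (at s)"
        unfolding \<phi>_def by (rule has_derivative_diff)
      moreover have "(\<lambda>h. g (y + s *\<^sub>R v + t *\<^sub>R w) \<bullet> (h *\<^sub>R v) - g (y + s *\<^sub>R v) \<bullet> (h *\<^sub>R v)) =
          (*) ((g (y + s *\<^sub>R v + t *\<^sub>R w) - g (y + s *\<^sub>R v)) \<bullet> v)"
        by (simp add: fun_eq_iff inner_diff_left algebra_simps)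
      ultimately show ?thesis by (simp add: has_field_derivative_def)
    qed
    obtain s where s: "0 < s" "s < t"
        "\<phi> t - \<phi> 0 = (t - 0) * ((g (y + s *\<^sub>R v + t *\<^sub>R w) - g (y + s *\<^sub>R v)) \<bullet> v)"
      using MVT2[OF t(1), of \<phi> "\<lambda>s. (g (y + s *\<^sub>R v + t *\<^sub>R w) - g (y + s *\<^sub>R v)) \<bullet> v"] der by blast
    define r1 where "r1 = g (y + s *\<^sub>R v + t *\<^sub>R w) - g y - L (s *\<^sub>R v + t *\<^sub>R w)"
    define r2 where "r2 = g (y + s *\<^sub>R v) - g y - L (s *\<^sub>R v)"
    have r1: "norm r1 \<le> e * (t * K)"
    proof -
      have "norm r1 \<le> e * norm (s *\<^sub>R v + t *\<^sub>R w)"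
        using d2(2)[of "y + s *\<^sub>R v + t *\<^sub>R w"] small[of s t] s tK
        by (simp add: r1_def add.assoc)
      also have "\<dots> \<le> e * (t * K)" using small[of s t] s e by (intro mult_left_mono) auto
      finally show ?thesis .
    qed
    have r2: "norm r2 \<le> e * (t * K)"
    proof -
      have "norm r2 \<le> e * norm (s *\<^sub>R v)"
        using d2(2)[of "y + s *\<^sub>R v"] small[of s 0] s tK t by (simp add: r2_def)
      also have "\<dots> \<le> e * (t * K)" using small[of s 0] s t e by (intro mult_left_mono) auto
      finally show ?thesis .
    qed
    have "g (y + s *\<^sub>R v + t *\<^sub>R w) - g (y + s *\<^sub>R v) = t *\<^sub>R L w + (r1 - r2)"
      by (simp add: r1_def r2_def linear_add[OF lin] linear_scale[OF lin])
    then have "\<phi> t - \<phi> 0 = t * ((t *\<^sub>R L w + (r1 - r2)) \<bullet> v)"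
      using s(3) by (simp only: diff_zero)
    then have "\<phi> t - \<phi> 0 - t\<^sup>2 * (L w \<bullet> v) = t * ((r1 - r2) \<bullet> v)"
      by (simp add: inner_add_left power2_eq_square algebra_simps)
    moreover have "\<bar>(r1 - r2) \<bullet> v\<bar> \<le> t * \<epsilon>"
    proof -
      have "\<bar>(r1 - r2) \<bullet> v\<bar> \<le> norm (r1 - r2) * norm v" by (rule Cauchy_Schwarz_ineq2)
      also have "\<dots> \<le> (2 * (e * (t * K))) * K"
        using norm_triangle_ineq4[of r1 r2] r1 r2 K e t(1) by (intro mult_mono) auto
      also have "\<dots> = t * \<epsilon>" using K by (simp add: e_def)
      finally show ?thesis .
    qed
    ultimately have "\<bar>\<phi> t - \<phi> 0 - t\<^sup>2 * (L w \<bullet> v)\<bar> \<le> t\<^sup>2 * \<epsilon>"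
      using t(1) by (simp add: abs_mult power2_eq_square mult.assoc)
    then show "\<bar>u (y + t *\<^sub>R v + t *\<^sub>R w) - u (y + t *\<^sub>R v) - u (y + t *\<^sub>R w) + u y - t\<^sup>2 * (L w \<bullet> v)\<bar> \<le> t\<^sup>2 * \<epsilon>"
      by (simp add: \<phi>_def algebra_simps)
  qed
qed

lemma second_derivative_symmetric:
  fixes u :: "'a::real_inner \<Rightarrow> real"
  assumes u: "\<forall>\<^sub>F x in nhds y. (u has_derivative (\<lambda>h. g x \<bullet> h)) (at x)"
    and g: "(g has_derivative L) (at y)"
  shows "L w \<bullet> v = L v \<bullet> w"
proof -
  have "\<bar>L w \<bullet> v - L v \<bullet> w\<bar> \<le> 0 + \<epsilon>" if "0 < \<epsilon>" for \<epsilon>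
  proof -
    let ?D = "\<lambda>v w t. u (y + t *\<^sub>R v + t *\<^sub>R w) - u (y + t *\<^sub>R v) - u (y + t *\<^sub>R w) + u y"
    have e2: "0 < \<epsilon> / 2" using that by simp
    obtain d1 where d1: "0 < d1" "\<And>t. 0 < t \<Longrightarrow> t < d1 \<Longrightarrow> \<bar>?D v w t - t\<^sup>2 * (L w \<bullet> v)\<bar> \<le> t\<^sup>2 * (\<epsilon> / 2)"
      using second_difference_quotient[OF u g e2, of v w] by blast
    obtain d2 where d2: "0 < d2" "\<And>t. 0 < t \<Longrightarrow> t < d2 \<Longrightarrow> \<bar>?D w v t - t\<^sup>2 * (L v \<bullet> w)\<bar> \<le> t\<^sup>2 * (\<epsilon> / 2)"
      using second_difference_quotient[OF u g e2, of w v] by blast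
    define t where "t = min d1 d2 / 2"
    have t: "0 < t" "t < d1" "t < d2" using d1(1) d2(1) by (auto simp: t_def min_def)
    have "?D v w t = ?D w v t" by (simp add: add_ac)
    then have "\<bar>t\<^sup>2 * (L w \<bullet> v) - t\<^sup>2 * (L v \<bullet> w)\<bar> \<le> t\<^sup>2 * (\<epsilon> / 2) + t\<^sup>2 * (\<epsilon> / 2)"
      using d1(2)[OF t(1,2)] d2(2)[OF t(1,3)] by linarith
    also have "\<dots> = t\<^sup>2 * \<epsilon>" by simp
    finally have "t\<^sup>2 * \<bar>L w \<bullet> v - L v \<bullet> w\<bar> \<le> t\<^sup>2 * \<epsilon>"
      by (simp add: abs_mult flip: right_diff_distrib)
    then show ?thesis using t(1) by simp
  qed
  then have "\<bar>L w \<bullet> v - L v \<bullet> w\<bar> \<le> 0" by (rule field_le_epsilon)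
  then show ?thesis by simp
qed

lemma has_derivative_grad:
  fixes f :: "real ^ 'n::finite \<Rightarrow> real"
  assumes "f differentiable (at x)"
  shows "(f has_derivative (\<lambda>h. grad f x \<bullet> h)) (at x)"
proof -
  let ?D = "frechet_derivative f (at x)"
  have D: "(f has_derivative ?D) (at x)" using assms by (simp add: frechet_derivative_works)
  then have lin: "linear ?D" by (rule has_derivative_linear)
  have "?D h = grad f x \<bullet> h" for h
  proof -
    have "?D h = ?D (\<Sum>i\<in>UNIV. h $ i *\<^sub>R axis i 1)"
      by (simp add: basis_expansion[of h, unfolded scalar_mult_eq_scaleR])
    also have "\<dots> = (\<Sum>i\<in>UNIV. h $ i * ?D (axis i 1))"
      by (simp add: linear_sum[OF lin] linear_scale[OF lin])
    also have "\<dots> = grad f x \<bullet> h"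
      by (simp add: inner_vec_def grad_def mult.commute)
    finally show ?thesis .
  qed
  then show ?thesis using D by (metis (no_types, lifting) ext)
qed

lemma C2_on_eventually_grad:
  fixes u :: "real ^ 'n::finite \<Rightarrow> real"
  assumes "C2_on S u" "open S" "y \<in> S"
  shows "\<forall>\<^sub>F x in nhds y. (u has_derivative (\<lambda>h. grad u x \<bullet> h)) (at x)"
  using eventually_nhds_in_open[OF assms(2,3)]
  by eventually_elim (use assms(1) in \<open>auto simp: C2_on_def intro: has_derivative_grad\<close>)

lemma C2_on_grad_has_derivative:
  fixes u :: "real ^ 'n::finite \<Rightarrow> real"
  assumes "C2_on S u" "y \<in> S"
  shows "(grad u has_derivative (\<lambda>h. hessian u y *v h)) (at y)"
  using assms by (simp add: C2_on_def hessian_def jacobian_works)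

lemma hessian_symmetric:
  fixes u :: "real ^ 'n::finite \<Rightarrow> real"
  assumes "C2_on S u" "open S" "y \<in> S"
  shows "v \<bullet> (hessian u y *v w) = w \<bullet> (hessian u y *v v)"
  using second_derivative_symmetric[OF C2_on_eventually_grad[OF assms] C2_on_grad_has_derivative[OF assms(1,3)]]
  by (simp add: inner_commute)

lemma C2_on_jet2:
  fixes u :: "real ^ 'n::finite \<Rightarrow> real"
  assumes "C2_on S u" "open S" "y \<in> S"
  shows "jet2 (\<lambda>t. u (y + t *\<^sub>R v)) (grad u y \<bullet> v) (v \<bullet> (hessian u y *v v))"
  unfolding jet2_def
proof (intro exI[of _ "\<lambda>t. grad u (y + t *\<^sub>R v) \<bullet> v"] conjI)
  have "filterlim (\<lambda>t. y + t *\<^sub>R v) (nhds (y + 0 *\<^sub>R v)) (nhds 0)"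
    by (intro tendsto_intros filterlim_ident)
  then have "\<forall>\<^sub>F t in nhds 0. (u has_derivative (\<lambda>h. grad u (y + t *\<^sub>R v) \<bullet> h)) (at (y + t *\<^sub>R v))"
    using eventually_compose_filterlim[OF C2_on_eventually_grad[OF assms], of "\<lambda>t. y + t *\<^sub>R v"]
    by simp
  then show "\<forall>\<^sub>F t in nhds 0. ((\<lambda>t. u (y + t *\<^sub>R v)) has_real_derivative grad u (y + t *\<^sub>R v) \<bullet> v) (at t)"
  proof eventually_elim
    case (elim t)
    have "((\<lambda>t. u (y + t *\<^sub>R v)) has_derivative (\<lambda>h. grad u (y + t *\<^sub>R v) \<bullet> (h *\<^sub>R v))) (at t)"
      by (rule has_derivative_line[OF elim])
    moreover have "(\<lambda>h. grad u (y + t *\<^sub>R v) \<bullet> (h *\<^sub>R v)) = (*) (grad u (y + t *\<^sub>R v) \<bullet> v)"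
      by (simp add: fun_eq_iff mult.commute)
    ultimately show ?case by (simp add: has_field_derivative_def)
  qed
  have G: "(grad u has_derivative (\<lambda>h. hessian u y *v h)) (at (y + 0 *\<^sub>R v))"
    using C2_on_grad_has_derivative[OF assms(1,3)] by simp
  have "((\<lambda>t. grad u (y + t *\<^sub>R v)) has_derivative (\<lambda>h. hessian u y *v (h *\<^sub>R v))) (at 0)"
    by (rule has_derivative_line[OF G])
  then have "((\<lambda>t. grad u (y + t *\<^sub>R v) \<bullet> v) has_derivative (\<lambda>h. (hessian u y *v (h *\<^sub>R v)) \<bullet> v)) (at 0)"
    by (rule has_derivative_inner_left)
  moreover have "(\<lambda>h. (hessian u y *v (h *\<^sub>R v)) \<bullet> v) = (*) (v \<bullet> (hessian u y *v v))"
    by (simp add: fun_eq_iff matrix_vector_mult_scaleR inner_commute mult.commute)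
  ultimately show "((\<lambda>t. grad u (y + t *\<^sub>R v) \<bullet> v) has_real_derivative v \<bullet> (hessian u y *v v)) (at 0)"
    by (simp add: has_field_derivative_def)
qed simp

lemma conformal_hessian_bilinear:
  fixes u :: "real ^ 'n::finite \<Rightarrow> real"
  shows "v \<bullet> (conformal_hessian u y *v w) =
    (let n = real CARD('n); g = grad u y in
      - (2 / (n - 2)) * u y powr (- (n + 2) / (n - 2)) * (v \<bullet> (hessian u y *v w))
      + 2 * n / (n - 2)\<^sup>2 * u y powr (- (2 * n) / (n - 2)) * ((g \<bullet> v) * (g \<bullet> w))
      - 2 / (n - 2)\<^sup>2 * u y powr (- (2 * n) / (n - 2)) * (norm g)\<^sup>2 * (v \<bullet> w))"
proof -
  have rank1: "(\<chi> i j. g $ i * g $ j) *v w = (g \<bullet> w) *\<^sub>R g" for g :: "real ^ 'n"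
    by (simp add: vec_eq_iff matrix_vector_mult_def inner_vec_def sum_distrib_left mult_ac)
  show ?thesis
    unfolding conformal_hessian_def Let_def
    by (simp add: matrix_vector_mult_add_rdistrib matrix_vector_mult_diff_rdistrib
        scaleR_matrix_vector_assoc[symmetric] rank1 inner_add_right inner_diff_right
        inner_commute mult_ac)
qed

lemma jet2_norm_powr:
  fixes d :: "'a::real_inner"
  assumes "d \<noteq> 0"
  shows "jet2 (\<lambda>t. norm (d + t *\<^sub>R v) powr p) (p * norm d powr (p - 2) * (d \<bullet> v))
    (p * (p - 2) * norm d powr (p - 4) * (d \<bullet> v)\<^sup>2 + p * norm d powr (p - 2) * (norm v)\<^sup>2)"
proof -
  have sq: "jet2 (\<lambda>t. (norm (d + t *\<^sub>R v))\<^sup>2) (2 * (d \<bullet> v)) (2 * (norm v)\<^sup>2)"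
    unfolding jet2_def
    by (intro exI[of _ "\<lambda>t. 2 * (d \<bullet> v) + 2 * t * (norm v)\<^sup>2"])
      (auto simp: power2_norm_eq_inner inner_add_left inner_add_right inner_commute algebra_simps
        intro!: always_eventually derivative_eq_intros)
  have pw: "((norm x)\<^sup>2) powr q = norm x powr (2 * q)" for x :: 'a and q
    by (cases "x = 0") (simp_all add: powr_powr flip: powr_numeral)
  show ?thesis
    using jet2_powr[OF sq, of "p / 2"] assms
    by (simp add: pw right_diff_distrib power_mult_distrib algebra_simps)
qed

section \<open>Test functions touching a power of u\<close>

locale admissible =
  fixes k :: nat and u :: "real ^ 'n::finite \<Rightarrow> real"
  assumes card_ge: "CARD('n) \<ge> 3"
    and k_gt: "real CARD('n) / 2 < real k" and k_le: "k \<le> CARD('n)"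
    and C2: "C2_on (ball 0 2 - {0}) u"
    and u_pos: "\<And>x. x \<in> ball 0 2 - {0} \<Longrightarrow> 0 < u x"
    and cone: "\<And>x. x \<in> ball 0 2 - {0} \<Longrightarrow>
      \<exists>l. eigenvalue_vector (conformal_hessian u x) l \<and> l \<in> closure (Gamma_cone k)"
begin

text \<open>\<open>c\<close> is the constant of the pinching inequality. The hypothesis \<open>k > n/2\<close> says exactly that \<open>c < 1\<close>,
  and the Hoelder exponent is \<open>\<alpha> = 1 - c\<close>.\<close>

definition N where "N = real CARD('n)"
definition c where "c = (N - real k) / real k"
definition \<alpha> where "\<alpha> = (2 * real k - N) / real k"

lemma k_pos: "1 \<le> k" "0 < real k"
  using k_gt card_ge by (auto intro: Suc_leI gr0I)

lemma const_bounds: "3 \<le> N" "0 \<le> c" "c < 1" "0 < \<alpha>" "\<alpha> \<le> 1" "c = 1 - \<alpha>"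
  using card_ge k_gt k_le k_pos by (auto simp: N_def c_def \<alpha>_def field_simps)

lemma open_dom: "open (ball 0 2 - {0 :: real ^ 'n})"
  by (intro open_Diff) auto

text \<open>A power \<open>z = u\<^bsup>\<kappa>\<^esup>\<close> that is touched by a test function \<open>\<psi>\<close> transfers the pinching inequality to \<open>\<psi>\<close>.
  For \<open>\<mu> = (n - 2) \<kappa>\<close> the quadratic form of the conformal Hessian in a unit direction \<open>v\<close> is a
  positive multiple of \<open>- \<mu> z \<partial>\<^sub>v\<^sub>v z + (\<mu> + 2) (\<partial>\<^sub>v z)\<^sup>2 - |\<nabla>z|\<^sup>2\<close>. At an extremum of \<open>z - \<psi>\<close> the
  gradients agree, and the second derivatives are ordered in the direction that makes this
  expression grow when \<open>z\<close> is replaced by \<open>\<psi>\<close> in the derivatives. The sign of \<open>\<mu>\<close> decides whether \<open>\<psi>\<close>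
  touches from above or from below. The values \<open>z(y)\<close> and \<open>\<psi>(y)\<close> may differ, so that constants can be
  added to \<open>\<psi>\<close>.\<close>

lemma touching:
  assumes y: "y \<in> ball 0 2 - {0}" and \<kappa>: "\<kappa> \<noteq> 0" and \<mu>: "\<mu> = (N - 2) * \<kappa>"
    and jet: "\<And>v. jet2 (\<lambda>t. \<psi> (y + t *\<^sub>R v)) (g \<bullet> v) (H v)"
    and min: "\<forall>\<^sub>F x in nhds y. \<mu> * (u y powr \<kappa> - \<psi> y) \<le> \<mu> * (u x powr \<kappa> - \<psi> x)"
    and e: "norm e = 1"
    and L: "\<And>v. norm v = 1 \<Longrightarrow>
      - \<mu> * u y powr \<kappa> * H v + (\<mu> + 2) * (g \<bullet> v)\<^sup>2 - (norm g)\<^sup>2 \<le> L"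
  shows "0 \<le> - \<mu> * u y powr \<kappa> * H e + (\<mu> + 2) * (g \<bullet> e)\<^sup>2 - (norm g)\<^sup>2 + c * L"
proof -
  define U where "U = u y"
  have U: "0 < U" using u_pos[OF y] by (simp add: U_def)
  define z where "z = U powr \<kappa>"
  define q where "q = U powr (- 4 / (N - 2))"
  have zq: "0 < z" "0 < q" using U by (auto simp: z_def q_def)
  have N2: "0 < N - 2" using const_bounds(1) by simp
  define G where "G = grad u y"
  define Q where "Q v = v \<bullet> (hessian u y *v v)" for v
  have pw: "U powr (\<kappa> - 1) = z / U" "U powr (\<kappa> - 2) = z / U\<^sup>2"
      "U powr (- (N + 2) / (N - 2)) = q / U" "U powr (- (2 * N) / (N - 2)) = q / U\<^sup>2"
  proof -
    show "U powr (\<kappa> - 1) = z / U" using U by (simp add: z_def powr_diff)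
    show "U powr (\<kappa> - 2) = z / U\<^sup>2" using U by (simp add: z_def powr_diff powr_numeral)
    have "- (N + 2) / (N - 2) = - 4 / (N - 2) - 1" using N2 by (simp add: field_simps)
    then show "U powr (- (N + 2) / (N - 2)) = q / U" using U by (simp add: q_def powr_diff)
    have "- (2 * N) / (N - 2) = - 4 / (N - 2) - 2" using N2 by (simp add: field_simps)
    then show "U powr (- (2 * N) / (N - 2)) = q / U\<^sup>2"
      using U by (simp add: q_def powr_diff powr_numeral)
  qed
  have jz: "jet2 (\<lambda>t. u (y + t *\<^sub>R v) powr \<kappa>) (\<kappa> * (z / U) * (G \<bullet> v))
     (\<kappa> * (\<kappa> - 1) * (z / U\<^sup>2) * (G \<bullet> v)\<^sup>2 + \<kappa> * (z / U) * Q v)" for v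
    using jet2_powr[OF C2_on_jet2[OF C2 open_dom y, of v], of \<kappa>] U
    by (simp add: pw Q_def G_def flip: U_def)
  have loc: "g \<bullet> v = \<kappa> * (z / U) * (G \<bullet> v)"
    "\<mu> * H v \<le> \<mu> * (\<kappa> * (\<kappa> - 1) * (z / U\<^sup>2) * (G \<bullet> v)\<^sup>2 + \<kappa> * (z / U) * Q v)" for v
  proof -
    have j: "jet2 (\<lambda>t. \<mu> * (u (y + t *\<^sub>R v) powr \<kappa> - \<psi> (y + t *\<^sub>R v)))
      (\<mu> * (\<kappa> * (z / U) * (G \<bullet> v) - g \<bullet> v))
      (\<mu> * (\<kappa> * (\<kappa> - 1) * (z / U\<^sup>2) * (G \<bullet> v)\<^sup>2 + \<kappa> * (z / U) * Q v - H v))"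
      by (intro jet2_cmult jet2_diff jz jet)
    have "filterlim (\<lambda>t. y + t *\<^sub>R v) (nhds (y + 0 *\<^sub>R v)) (nhds 0)"
      by (intro tendsto_intros filterlim_ident)
    then have m: "\<forall>\<^sub>F t in nhds 0. \<mu> * (u (y + 0 *\<^sub>R v) powr \<kappa> - \<psi> (y + 0 *\<^sub>R v)) \<le>
        \<mu> * (u (y + t *\<^sub>R v) powr \<kappa> - \<psi> (y + t *\<^sub>R v))"
      using eventually_compose_filterlim[OF min, of "\<lambda>t. y + t *\<^sub>R v" "nhds 0"] by simp
    have "\<mu> \<noteq> 0" using \<mu> \<kappa> N2 by simp
    then show "g \<bullet> v = \<kappa> * (z / U) * (G \<bullet> v)"
      using jet2_local_min(1)[OF j m] by simp
    show "\<mu> * H v \<le> \<mu> * (\<kappa> * (\<kappa> - 1) * (z / U\<^sup>2) * (G \<bullet> v)\<^sup>2 + \<kappa> * (z / U) * Q v)"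
      using jet2_local_min(2)[OF j m] by (simp add: right_diff_distrib)
  qed
  have g: "g = (\<kappa> * (z / U)) *\<^sub>R G"
  proof -
    have "(g - (\<kappa> * (z / U)) *\<^sub>R G) \<bullet> v = 0" for v
      using loc(1)[of v] by (simp add: inner_diff_left)
    then show ?thesis by (metis inner_eq_zero_iff right_minus_eq)
  qed
  let ?M = "conformal_hessian u y"
  \<comment> \<open>\<open>?K\<close> is the positive multiple, as found by substituting \<open>g = \<kappa> u\<^bsup>\<kappa>-1\<^esup> \<nabla>u\<close>.\<close>
  let ?K = "2 * q / (\<kappa>\<^sup>2 * (N - 2)\<^sup>2 * z\<^sup>2)"
  let ?P = "\<lambda>v. - \<mu> * z * H v + (\<mu> + 2) * (g \<bullet> v)\<^sup>2 - (norm g)\<^sup>2"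
  have K: "0 < ?K" using zq \<kappa> N2 by simp
  have M: "v \<bullet> (?M *v w) = - (2 / (N - 2)) * (q / U) * (v \<bullet> (hessian u y *v w))
      + 2 * N / (N - 2)\<^sup>2 * (q / U\<^sup>2) * ((G \<bullet> v) * (G \<bullet> w))
      - 2 / (N - 2)\<^sup>2 * (q / U\<^sup>2) * (norm G)\<^sup>2 * (v \<bullet> w)" for v w
    unfolding conformal_hessian_bilinear Let_def N_def[symmetric] U_def[symmetric] pw G_def ..
  have MP: "v \<bullet> (?M *v v) \<le> ?K * ?P v" if "norm v = 1" for v
  proof -
    have "v \<bullet> v = 1" using that by (metis norm_eq_1)
    then have "v \<bullet> (?M *v v) = - (2 / (N - 2)) * (q / U) * Q v
      + 2 * N / (N - 2)\<^sup>2 * (q / U\<^sup>2) * (G \<bullet> v)\<^sup>2 - 2 / (N - 2)\<^sup>2 * (q / U\<^sup>2) * (norm G)\<^sup>2"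
      by (simp add: M Q_def power2_eq_square)
    also have "\<dots> = ?K * (- z * (\<mu> * (\<kappa> * (\<kappa> - 1) * (z / U\<^sup>2) * (G \<bullet> v)\<^sup>2 + \<kappa> * (z / U) * Q v))
        + (\<mu> + 2) * (\<kappa> * (z / U) * (G \<bullet> v))\<^sup>2 - (\<kappa> * (z / U))\<^sup>2 * (norm G)\<^sup>2)"
      using U zq \<kappa> N2 unfolding \<mu> by (simp add: divide_simps) (simp add: power2_eq_square algebra_simps)
    also have "\<dots> \<le> ?K * ?P v"
    proof -
      have "(norm g)\<^sup>2 = (\<kappa> * (z / U))\<^sup>2 * (norm G)\<^sup>2"
        unfolding g by (simp only: norm_scaleR power_mult_distrib power2_abs)
      moreover have "- z * (\<mu> * (\<kappa> * (\<kappa> - 1) * (z / U\<^sup>2) * (G \<bullet> v)\<^sup>2 + \<kappa> * (z / U) * Q v)) \<le> - z * (\<mu> * H v)"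
        by (rule mult_left_mono_neg[OF loc(2)]) (use zq(1) in simp)
      ultimately show ?thesis
        using K unfolding loc(1) by (intro mult_left_mono) (auto simp: mult_ac)
    qed
    finally show ?thesis .
  qed
  obtain l where l: "eigenvalue_vector ?M l" "l \<in> closure (Gamma_cone k)"
    using cone[OF y] by blast
  have "v \<bullet> (?M *v w) = w \<bullet> (?M *v v)" for v w
    unfolding M using hessian_symmetric[OF C2 open_dom y, of v w] by (simp add: inner_commute)
  moreover have "v \<bullet> (?M *v v) \<le> ?K * L" if "norm v = 1" for v
  proof -
    have "?P v \<le> L" using L[OF that] by (simp add: z_def U_def)
    then have "?K * ?P v \<le> ?K * L" using K by (intro mult_left_mono) auto
    then show ?thesis using MP[OF that] by simp
  qed
  ultimately have "0 \<le> e \<bullet> (?M *v e) + (real CARD('n) - real k) / real k * (?K * L)"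
    by (intro rayleigh_pinching[OF k_pos(1) k_le _ l _ e])
  also have "\<dots> = e \<bullet> (?M *v e) + ?K * (c * L)"
    by (simp add: c_def N_def mult_ac)
  also have "\<dots> \<le> ?K * ?P e + ?K * (c * L)"
    using MP[OF e] by (rule add_right_mono)
  also have "\<dots> = ?K * (?P e + c * L)"
    by (rule distrib_left[symmetric])
  finally have "0 \<le> ?P e + c * L" using K by (metis zero_le_mult_iff not_le)
  then show ?thesis by (simp add: z_def U_def)
qed

end

section \<open>A minimum principle across the puncture\<close>

lemma ex_unit_orthogonal:
  fixes a b :: "'a::euclidean_space"
  assumes "3 \<le> DIM('a)"
  obtains e where "norm e = 1" "a \<bullet> e = 0" "b \<bullet> e = 0"
proof -
  have "dim {a, b} \<le> card {a, b}" by (rule dim_le_card') simp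
  also have "\<dots> \<le> 2" by (simp add: card_insert_if)
  finally have "dim {a, b} < DIM('a)" using assms by simp
  then obtain x where x: "x \<noteq> 0" "\<And>y. y \<in> span {a, b} \<Longrightarrow> orthogonal x y"
    by (rule orthogonal_to_subspace_exists) (rule that, auto)
  show ?thesis
    using x span_base[of a "{a, b}"] span_base[of b "{a, b}"]
    by (intro that[of "x /\<^sub>R norm x"]) (auto simp: orthogonal_def inner_commute)
qed

context admissible
begin

text \<open>\<open>u\<^bsup>-\<theta>\<^esup> = \<xi>\<^bsup>\<alpha>/2\<^esup>\<close> is the power of \<open>u\<close> in which radial solutions of \<open>\<sigma>\<^sub>k = 0\<close> become \<open>a + b |x - x\<^sub>0|\<^bsup>\<alpha>\<^esup>\<close>, and
  \<open>u\<^bsup>\<theta>\<^esup>\<close> is its reciprocal.\<close>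

definition \<theta> where "\<theta> = \<alpha> / (N - 2)"

lemma \<theta>: "0 < \<theta>" "(N - 2) * \<theta> = \<alpha>" "(N - 2) * (- \<theta>) = - \<alpha>"
  using const_bounds by (auto simp: \<theta>_def)

lemma continuous_on_u: "continuous_on (ball 0 2 - {0}) u"
  using C2 by (auto simp: C2_on_def intro!: continuous_at_imp_continuous_on differentiable_imp_continuous_within)

lemma continuous_on_u_powr:
  assumes "S \<subseteq> ball 0 2 - {0}"
  shows "continuous_on S (\<lambda>x. u x powr p)"
proof -
  have "continuous_on S u" "\<And>x. x \<in> S \<Longrightarrow> u x \<noteq> 0"
    using continuous_on_subset[OF continuous_on_u assms] u_pos assms by force+
  then show ?thesis by (intro continuous_intros) auto
qed

text \<open>The barrier \<open>A + B \<bullet> x - \<tau> |x|\<^bsup>-\<gamma>\<^esup>\<close> is negative near the origin and hence lies below the positive function \<open>u\<^bsup>\<theta>\<^esup>\<close>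
  there; were it to touch \<open>u\<^bsup>\<theta>\<^esup>\<close> from below at some \<open>y\<close>, the pinching inequality would fail there. The
  offending direction is tangential: minus the Hessian of the barrier is negative in tangential
  directions and, in absolute value, only \<open>\<gamma> + 1\<close> times as large radially; and the gradient terms
  are harmless in a direction orthogonal to the gradient. Such a direction exists because \<open>n \<ge> 3\<close>.
  Then \<open>\<tau> \<rightarrow> 0\<close>.\<close>

lemma affine_minimum_principle:
  assumes \<rho>: "0 < \<rho>" "\<rho> < 2"
    and bd: "\<And>x. norm x = \<rho> \<Longrightarrow> A + B \<bullet> x \<le> u x powr \<theta>"
    and x: "x \<noteq> 0" "norm x < \<rho>"
  shows "A + B \<bullet> x \<le> u x powr \<theta>"
proof -
  \<comment> \<open>Any \<open>\<gamma> > 0\<close> with \<open>c (\<gamma> + 1) < 1\<close> would do.\<close>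
  define \<gamma> where "\<gamma> = \<alpha> / 2"
  have \<gamma>: "0 < \<gamma>" "c * (\<gamma> + 1) < 1"
  proof -
    show "0 < \<gamma>" using const_bounds by (simp add: \<gamma>_def)
    have "c * (\<gamma> + 1) = 1 - \<alpha> * (1 + \<alpha>) / 2"
      unfolding const_bounds(6) \<gamma>_def by (simp add: field_simps)
    also have "\<dots> < 1" using const_bounds by simp
    finally show "c * (\<gamma> + 1) < 1" .
  qed
  have bar: "A + B \<bullet> x1 - \<tau> * norm x1 powr (- \<gamma>) \<le> u x1 powr \<theta>"
    if \<tau>: "0 < \<tau>" and x1: "x1 \<noteq> 0" "norm x1 < \<rho>" for \<tau> x1
  proof (rule ccontr)
    define \<Phi> where "\<Phi> z = A + B \<bullet> z - \<tau> * norm z powr (- \<gamma>)" for z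
    define f where "f z = u z powr \<theta> - \<Phi> z" for z
    assume "\<not> A + B \<bullet> x1 - \<tau> * norm x1 powr (- \<gamma>) \<le> u x1 powr \<theta>"
    then have f1: "f x1 < 0" by (simp add: f_def \<Phi>_def)
    define C where "C = \<bar>A\<bar> + norm B * \<rho> + 1"
    have C: "0 < C" using \<rho> by (simp add: C_def add_nonneg_pos)
    \<comment> \<open>Inside the ball of radius \<open>\<delta>\<close> the singular term outweighs the affine one.\<close>
    define \<delta> where "\<delta> = (\<tau> / C) powr (1 / \<gamma>)"
    have \<delta>: "0 < \<delta>" using \<tau> C by (simp add: \<delta>_def)
    have near: "0 < f z" if z: "z \<noteq> 0" "norm z < \<delta>" "norm z \<le> \<rho>" for z
    proof -
      have "norm z powr \<gamma> \<le> \<delta> powr \<gamma>" using z \<gamma> by (intro powr_mono2) auto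
      also have "\<dots> = \<tau> / C" using \<gamma> \<tau> C by (simp add: \<delta>_def powr_powr)
      finally have "C \<le> \<tau> * norm z powr (- \<gamma>)"
        using z C by (simp add: powr_minus field_simps)
      moreover have "B \<bullet> z \<le> norm B * \<rho>"
        using norm_cauchy_schwarz[of B z] mult_left_mono[OF z(3), of "norm B"] by simp
      ultimately have "\<Phi> z < 0" unfolding \<Phi>_def C_def by linarith
      moreover have "0 \<le> u z powr \<theta>" by simp
      ultimately show ?thesis unfolding f_def by linarith
    qed
    let ?K = "cball 0 \<rho> - ball 0 \<delta> :: (real ^ 'n) set"
    have Ksub: "?K \<subseteq> ball 0 2 - {0}" using \<rho> \<delta> by auto
    have "compact ?K" by (intro compact_diff) auto
    moreover have x1K: "x1 \<in> ?K" using near[of x1] x1 f1 by force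
    moreover have "continuous_on ?K f"
      unfolding f_def \<Phi>_def
      by (intro continuous_intros continuous_on_u_powr Ksub) (use \<delta> in auto)
    ultimately obtain y where y: "y \<in> ?K" "\<And>z. z \<in> ?K \<Longrightarrow> f y \<le> f z"
      using continuous_attains_inf[of ?K f] by blast
    have fy: "f y < 0" using y(2)[OF x1K] f1 by simp
    have y0: "y \<noteq> 0" using y(1) \<delta> by auto
    have y\<rho>: "norm y < \<rho>"
    proof (rule ccontr)
      assume "\<not> norm y < \<rho>"
      then have "norm y = \<rho>" using y(1) by simp
      moreover have "0 < \<tau> * norm y powr (- \<gamma>)" using \<tau> y0 by simp
      ultimately have "0 < f y"
        using bd[of y] unfolding f_def \<Phi>_def by linarith
      then show False using fy by simp
    qed
    have all: "f y \<le> f z" if "z \<noteq> 0" "norm z < \<rho>" for z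
      using y(2)[of z] near[of z] that fy by (cases "norm z < \<delta>") force+
    define r where "r = norm y"
    have r: "0 < r" using y0 by (simp add: r_def)
    define w where "w = u y powr \<theta>"
    have ydom: "y \<in> ball 0 2 - {0}" using y(1) Ksub by blast
    have w: "0 < w" using u_pos[OF ydom] by (simp add: w_def)
    define T where "T = \<tau> * \<gamma> * r powr (- \<gamma> - 2)"
    have T: "0 < T" using \<tau> \<gamma> r by (simp add: T_def)
    define g where "g = B + T *\<^sub>R y"
    define H where "H v = T * ((norm v)\<^sup>2 - (\<gamma> + 2) * (y \<bullet> v)\<^sup>2 / r\<^sup>2)" for v
    have jet: "jet2 (\<lambda>t. \<Phi> (y + t *\<^sub>R v)) (g \<bullet> v) (H v)" for v
    proof -
      have r4: "r powr (- \<gamma> - 4) = r powr (- \<gamma> - 2) / r\<^sup>2"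
        using r powr_diff[of r "- \<gamma> - 2" 2] by (simp add: powr_numeral algebra_simps)
      have "jet2 (\<lambda>t. ((A + B \<bullet> y) + t * (B \<bullet> v)) - \<tau> * norm (y + t *\<^sub>R v) powr (- \<gamma>))
        (B \<bullet> v - \<tau> * (- \<gamma> * norm y powr (- \<gamma> - 2) * (y \<bullet> v)))
        (0 - \<tau> * (- \<gamma> * (- \<gamma> - 2) * norm y powr (- \<gamma> - 4) * (y \<bullet> v)\<^sup>2 +
           - \<gamma> * norm y powr (- \<gamma> - 2) * (norm v)\<^sup>2))"
        by (intro jet2_diff jet2_affine jet2_cmult jet2_norm_powr y0)
      then show ?thesis
        unfolding r_def[symmetric] r4
        by (simp add: \<Phi>_def g_def H_def T_def inner_add_left inner_add_right algebra_simps
            diff_divide_distrib add_divide_distrib)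
    qed
    have min: "\<forall>\<^sub>F z in nhds y. \<alpha> * (u y powr \<theta> - \<Phi> y) \<le> \<alpha> * (u z powr \<theta> - \<Phi> z)"
    proof -
      have "open (ball 0 \<rho> - {0} :: (real ^ 'n) set)" by (intro open_Diff) auto
      then have "\<forall>\<^sub>F z in nhds y. z \<in> ball 0 \<rho> - {0}"
        using y0 y\<rho> by (intro eventually_nhds_in_open) auto
      then show ?thesis
      proof eventually_elim
        case (elim z)
        then show ?case
          using all[of z] const_bounds by (intro mult_left_mono) (auto simp: f_def)
      qed
    qed
    obtain e where e: "norm e = 1" "y \<bullet> e = 0" "B \<bullet> e = 0"
      using ex_unit_orthogonal[of y B] card_ge by auto
    let ?L = "\<alpha> * w * (T * (\<gamma> + 1)) + (\<alpha> + 1) * (norm g)\<^sup>2"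
    have L: "- \<alpha> * u y powr \<theta> * H v + (\<alpha> + 2) * (g \<bullet> v)\<^sup>2 - (norm g)\<^sup>2 \<le> ?L" if v: "norm v = 1" for v
    proof -
      have "(y \<bullet> v)\<^sup>2 \<le> r\<^sup>2"
        using Cauchy_Schwarz_ineq2[of y v] v by (simp add: r_def abs_le_square_iff[symmetric])
      then have "(\<gamma> + 2) * ((y \<bullet> v)\<^sup>2 / r\<^sup>2) \<le> (\<gamma> + 2) * 1"
        using \<gamma> r by (intro mult_left_mono) auto
      then have "T * (- (\<gamma> + 1)) \<le> H v"
        unfolding H_def using T v by (intro mult_left_mono) auto
      then have "- H v \<le> T * (\<gamma> + 1)" by (simp add: algebra_simps)
      then have "\<alpha> * w * (- H v) \<le> \<alpha> * w * (T * (\<gamma> + 1))"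
        using const_bounds w by (intro mult_left_mono) auto
      moreover have "(g \<bullet> v)\<^sup>2 \<le> (norm g)\<^sup>2"
        using Cauchy_Schwarz_ineq2[of g v] v by (simp add: abs_le_square_iff[symmetric])
      then have "(\<alpha> + 2) * (g \<bullet> v)\<^sup>2 \<le> (\<alpha> + 2) * (norm g)\<^sup>2"
        using const_bounds by (intro mult_left_mono) auto
      ultimately show ?thesis by (simp add: w_def algebra_simps)
    qed
    have "0 \<le> - \<alpha> * u y powr \<theta> * H e + (\<alpha> + 2) * (g \<bullet> e)\<^sup>2 - (norm g)\<^sup>2 + c * ?L"
      by (rule touching[OF ydom _ \<theta>(2)[symmetric] jet min e(1) L]) (use \<theta> in auto)
    also have "\<dots> = - (\<alpha> * w * T * (1 - c * (\<gamma> + 1))) - (1 - c * (\<alpha> + 1)) * (norm g)\<^sup>2"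
      using e by (simp add: H_def g_def w_def inner_add_left algebra_simps)
    also have "\<dots> < 0"
    proof -
      have "1 - c * (\<alpha> + 1) = \<alpha>\<^sup>2"
        unfolding const_bounds(6) by (simp add: power2_eq_square algebra_simps)
      then have "0 \<le> (1 - c * (\<alpha> + 1)) * (norm g)\<^sup>2" by simp
      moreover have "0 < \<alpha> * w * T * (1 - c * (\<gamma> + 1))"
        using const_bounds w T \<gamma> by simp
      ultimately show ?thesis by linarith
    qed
    finally show False by simp
  qed
  have "((\<lambda>\<tau>. A + B \<bullet> x - \<tau> * norm x powr (- \<gamma>)) \<longlongrightarrow> A + B \<bullet> x - 0 * norm x powr (- \<gamma>)) (at_right 0)"
    by (intro tendsto_intros)
  moreover have "\<forall>\<^sub>F \<tau> in at_right 0. A + B \<bullet> x - \<tau> * norm x powr (- \<gamma>) \<le> u x powr \<theta>"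
    using bar x by (auto simp: eventually_at_filter intro!: always_eventually)
  ultimately show ?thesis
    using tendsto_upperbound[of _ _ "at_right 0"] by fastforce
qed

end

section \<open>Comparison with radial profiles\<close>

lemma reciprocal_ge_tangent:
  fixes A t :: real
  assumes "0 < A" "0 < A + t"
  shows "1 / A - t / A\<^sup>2 \<le> 1 / (A + t)"
proof -
  have "1 / (A + t) - (1 / A - t / A\<^sup>2) = t\<^sup>2 / (A\<^sup>2 * (A + t))"
    using assms by (simp add: divide_simps) (simp add: power2_eq_square algebra_simps)
  moreover have "0 \<le> t\<^sup>2 / (A\<^sup>2 * (A + t))" using assms by simp
  ultimately show ?thesis by linarith
qed

context admissible
begin

text \<open>For \<open>\<beta> < \<alpha>\<close> the profile \<open>a + b |x - x\<^sub>0|\<^bsup>\<beta>\<^esup>\<close> violates the pinching inequality strictly, the radial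
  direction being the offending one, so it cannot touch \<open>u\<^bsup>-\<theta>\<^esup>\<close> from above, even after adding a
  positive constant. The violation has size at least \<open>\<delta> G\<^sup>2\<close>, where \<open>G\<close> is the length of the gradient
  of the profile, while a linear function of slope \<open>\<epsilon>\<close> perturbs the inequality by multiples of \<open>G \<epsilon>\<close>
  and \<open>\<epsilon>\<^sup>2\<close>; as \<open>G\<close> is bounded below on bounded sets, small slopes preserve the violation.\<close>

lemma no_perturbed_touching:
  assumes \<beta>: "0 < \<beta>" "\<beta> < \<alpha>" and b: "0 < b" and a: "0 \<le> a"
  obtains \<epsilon> where "0 < \<epsilon>"
    "\<And>y x0 p. y \<in> ball 0 2 - {0} \<Longrightarrow> norm x0 \<le> 2 \<Longrightarrow> y \<noteq> x0 \<Longrightarrow> norm p \<le> \<epsilon> \<Longrightarrow>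
       a + b * norm (y - x0) powr \<beta> \<le> u y powr (- \<theta>) \<Longrightarrow>
       \<not> (\<forall>\<^sub>F x in nhds y. u x powr (- \<theta>) - (a + b * norm (x - x0) powr \<beta> + p \<bullet> x) \<le>
            u y powr (- \<theta>) - (a + b * norm (y - x0) powr \<beta> + p \<bullet> y))"
proof -
  define \<delta> where "\<delta> = \<alpha> * (\<alpha> - \<beta>) / \<beta>"
  have \<delta>: "0 < \<delta>" using \<beta> const_bounds by (simp add: \<delta>_def)
  \<comment> \<open>The error terms will add up to at most \<open>16 \<eta> G\<^sup>2\<close>.\<close>
  define \<eta> where "\<eta> = min 1 (\<delta> / 17)"
  have \<eta>: "0 < \<eta>" "\<eta> \<le> 1" "16 * \<eta> < \<delta>" using \<delta> by (auto simp: \<eta>_def min_def)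
  \<comment> \<open>Since \<open>\<beta> < 1\<close>, the gradient is smallest at the greatest distance from \<open>x\<^sub>0\<close>, which is at most \<open>4\<close>.\<close>
  define Gm where "Gm = b * \<beta> * 4 powr (\<beta> - 1)"
  have Gm: "0 < Gm" using b \<beta> by (simp add: Gm_def)
  show ?thesis
  proof (rule that[of "Gm * \<eta>"], use Gm \<eta> in simp, rule notI)
    fix y x0 p :: "real ^ 'n"
    assume y: "y \<in> ball 0 2 - {0}" and x0: "norm x0 \<le> 2" "y \<noteq> x0" and p: "norm p \<le> Gm * \<eta>"
      and ge: "a + b * norm (y - x0) powr \<beta> \<le> u y powr (- \<theta>)"
      and max: "\<forall>\<^sub>F x in nhds y. u x powr (- \<theta>) - (a + b * norm (x - x0) powr \<beta> + p \<bullet> x) \<le>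
            u y powr (- \<theta>) - (a + b * norm (y - x0) powr \<beta> + p \<bullet> y)"
    define d where "d = y - x0"
    define r where "r = norm d"
    have r: "0 < r" "r \<le> 4"
      using x0 y norm_triangle_ineq4[of y x0] by (auto simp: r_def d_def)
    define G where "G = b * \<beta> * r powr (\<beta> - 1)"
    have G: "0 < G" using b \<beta> r by (simp add: G_def)
    have "4 powr (\<beta> - 1) \<le> r powr (\<beta> - 1)"
      using r \<beta> const_bounds by (intro powr_mono2') auto
    then have GmG: "Gm \<le> G"
      unfolding Gm_def G_def using b \<beta> by (intro mult_left_mono) auto
    define \<epsilon> where "\<epsilon> = norm p"
    have \<epsilon>: "0 \<le> \<epsilon>" "\<epsilon> \<le> G * \<eta>"
      using p mult_right_mono[OF GmG less_imp_le[OF \<eta>(1)]] by (auto simp: \<epsilon>_def)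
    define w where "w = u y powr (- \<theta>)"
    have rp: "r powr \<beta> = r * r powr (\<beta> - 1)" "r powr (\<beta> - 2) = r powr (\<beta> - 1) / r"
        "r powr (\<beta> - 4) = r powr (\<beta> - 1) / r / r\<^sup>2"
      using r powr_add[of r "\<beta> - 1" 1] powr_diff[of r "\<beta> - 1" 1] powr_diff[of r "\<beta> - 2" 2]
      by (simp_all add: powr_numeral)
    have wG: "r * G / \<beta> \<le> w"
    proof -
      have "r * G / \<beta> = b * r powr \<beta>"
        using \<beta> by (simp add: G_def rp(1))
      then show ?thesis
        using ge a unfolding w_def d_def[symmetric] r_def[symmetric] by linarith
    qed
    have w: "0 < w" using wG r G \<beta> by (smt (verit) divide_pos_pos mult_pos_pos)
    define e where "e = d /\<^sub>R r"
    have e: "norm e = 1" "d = r *\<^sub>R e" using r by (auto simp: e_def r_def)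
    define g where "g = G *\<^sub>R e + p"
    define H where "H v = G / r * ((\<beta> - 2) * (e \<bullet> v)\<^sup>2 + (norm v)\<^sup>2)" for v
    have jet: "jet2 (\<lambda>t. a + b * norm (y + t *\<^sub>R v - x0) powr \<beta> + p \<bullet> (y + t *\<^sub>R v)) (g \<bullet> v) (H v)" for v
    proof -
      have "d \<noteq> 0" using x0(2) by (simp add: d_def)
      have "jet2 (\<lambda>t. b * norm (d + t *\<^sub>R v) powr \<beta> + ((a + p \<bullet> y) + t * (p \<bullet> v)))
        (b * (\<beta> * norm d powr (\<beta> - 2) * (d \<bullet> v)) + p \<bullet> v)
        (b * (\<beta> * (\<beta> - 2) * norm d powr (\<beta> - 4) * (d \<bullet> v)\<^sup>2 + \<beta> * norm d powr (\<beta> - 2) * (norm v)\<^sup>2) + 0)"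
        by (intro jet2_add jet2_affine jet2_cmult jet2_norm_powr \<open>d \<noteq> 0\<close>)
      moreover have "b * norm (d + t *\<^sub>R v) powr \<beta> + ((a + p \<bullet> y) + t * (p \<bullet> v)) =
          a + b * norm (y + t *\<^sub>R v - x0) powr \<beta> + p \<bullet> (y + t *\<^sub>R v)" for t
        by (simp add: d_def inner_add_right algebra_simps)
      moreover have "b * (\<beta> * norm d powr (\<beta> - 2) * (d \<bullet> v)) + p \<bullet> v = g \<bullet> v"
        using r by (simp add: rp g_def G_def inner_add_left flip: r_def) (simp add: e(2))
      moreover have "b * (\<beta> * (\<beta> - 2) * norm d powr (\<beta> - 4) * (d \<bullet> v)\<^sup>2 +
          \<beta> * norm d powr (\<beta> - 2) * (norm v)\<^sup>2) + 0 = H v"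
      proof -
        have "(d \<bullet> v)\<^sup>2 = r\<^sup>2 * (e \<bullet> v)\<^sup>2" unfolding e(2) by (simp add: power_mult_distrib)
        then show ?thesis
          using r by (simp add: rp H_def G_def flip: r_def) (simp add: field_simps)
      qed
      ultimately show ?thesis by simp
    qed
    have min: "\<forall>\<^sub>F x in nhds y. - \<alpha> * (u y powr (- \<theta>) - (a + b * norm (y - x0) powr \<beta> + p \<bullet> y)) \<le>
        - \<alpha> * (u x powr (- \<theta>) - (a + b * norm (x - x0) powr \<beta> + p \<bullet> x))"
      using max by eventually_elim (rule mult_left_mono_neg, use const_bounds(4) in auto)
    define E where "E = 6 * G * \<epsilon> + 2 * \<epsilon>\<^sup>2"
    have gv: "(g \<bullet> v)\<^sup>2 \<le> G\<^sup>2 * (e \<bullet> v)\<^sup>2 + 2 * G * \<epsilon> + \<epsilon>\<^sup>2" if v: "norm v = 1" for v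
    proof -
      have 1: "\<bar>e \<bullet> v\<bar> \<le> 1" "\<bar>p \<bullet> v\<bar> \<le> \<epsilon>"
        using Cauchy_Schwarz_ineq2[of e v] Cauchy_Schwarz_ineq2[of p v] v e(1) by (auto simp: \<epsilon>_def)
      have "(g \<bullet> v)\<^sup>2 = G\<^sup>2 * (e \<bullet> v)\<^sup>2 + 2 * G * ((e \<bullet> v) * (p \<bullet> v)) + (p \<bullet> v)\<^sup>2"
        by (simp add: g_def inner_add_left power2_eq_square algebra_simps)
      moreover have "(e \<bullet> v) * (p \<bullet> v) \<le> 1 * \<epsilon>"
        using mult_mono[OF 1] by (simp only: abs_mult[symmetric]) (use abs_ge_self order_trans in fastforce)
      then have "2 * G * ((e \<bullet> v) * (p \<bullet> v)) \<le> 2 * G * \<epsilon>"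
        using G by (intro mult_left_mono) auto
      moreover have "(p \<bullet> v)\<^sup>2 \<le> \<epsilon>\<^sup>2" using 1(2) \<epsilon>(1) by (simp add: abs_le_square_iff[symmetric])
      ultimately show ?thesis by linarith
    qed
    have gg: "G\<^sup>2 - 2 * G * \<epsilon> \<le> (norm g)\<^sup>2"
    proof -
      have ee: "e \<bullet> e = 1" using e(1) by (simp add: norm_eq_1)
      have "g \<bullet> g = G\<^sup>2 * (e \<bullet> e) + 2 * G * (e \<bullet> p) + p \<bullet> p"
        by (simp add: g_def inner_add_left inner_add_right inner_commute[of p e] power2_eq_square
            algebra_simps)
      then have "(norm g)\<^sup>2 = G\<^sup>2 + 2 * G * (e \<bullet> p) + \<epsilon>\<^sup>2"
        by (simp add: \<epsilon>_def power2_norm_eq_inner ee)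
      moreover have "- (e \<bullet> p) \<le> \<epsilon>"
        using Cauchy_Schwarz_ineq2[of e p] e(1) by (auto simp: \<epsilon>_def)
      then have "2 * G * (- (e \<bullet> p)) \<le> 2 * G * \<epsilon>"
        using G by (intro mult_left_mono) auto
      moreover have "0 \<le> \<epsilon>\<^sup>2" by simp
      ultimately show ?thesis by linarith
    qed
    have quad: "- (- \<alpha>) * w * H v + (- \<alpha> + 2) * (g \<bullet> v)\<^sup>2 - (norm g)\<^sup>2 \<le>
        \<alpha> * w * (G / r * ((\<beta> - 2) * (e \<bullet> v)\<^sup>2 + 1)) + (2 - \<alpha>) * (G\<^sup>2 * (e \<bullet> v)\<^sup>2) - G\<^sup>2 + E"
      if v: "norm v = 1" for v
    proof -
      have "(2 - \<alpha>) * (g \<bullet> v)\<^sup>2 \<le> (2 - \<alpha>) * (G\<^sup>2 * (e \<bullet> v)\<^sup>2 + 2 * G * \<epsilon> + \<epsilon>\<^sup>2)"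
        using gv[OF v] const_bounds by (intro mult_left_mono) auto
      also have "\<dots> \<le> (2 - \<alpha>) * (G\<^sup>2 * (e \<bullet> v)\<^sup>2) + 2 * (2 * G * \<epsilon> + \<epsilon>\<^sup>2)"
      proof -
        have "(2 - \<alpha>) * (2 * G * \<epsilon> + \<epsilon>\<^sup>2) \<le> 2 * (2 * G * \<epsilon> + \<epsilon>\<^sup>2)"
          using const_bounds G \<epsilon> by (intro mult_right_mono) auto
        then show ?thesis by (simp add: algebra_simps)
      qed
      finally show ?thesis using gg v by (simp add: H_def E_def algebra_simps)
    qed
    let ?L = "\<alpha> * w * (G / r) - G\<^sup>2 + E"
    have L: "- (- \<alpha>) * u y powr (- \<theta>) * H v + (- \<alpha> + 2) * (g \<bullet> v)\<^sup>2 - (norm g)\<^sup>2 \<le> ?L"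
      if v: "norm v = 1" for v
    proof -
      have "(2 - \<alpha>) * G\<^sup>2 \<le> \<alpha> * w * (G / r) * (2 - \<beta>)"
      proof -
        have "(2 - \<alpha>) * \<beta> \<le> \<alpha> * (2 - \<beta>)" using \<beta> by (simp add: algebra_simps)
        then have "(2 - \<alpha>) * \<beta> * (G\<^sup>2 / \<beta>) \<le> \<alpha> * (2 - \<beta>) * (G\<^sup>2 / \<beta>)"
          using \<beta> by (intro mult_right_mono) auto
        also have "\<alpha> * (2 - \<beta>) * (G\<^sup>2 / \<beta>) = \<alpha> * (2 - \<beta>) * (G / r) * (r * G / \<beta>)"
          using r by (simp add: power2_eq_square)
        also have "\<dots> \<le> \<alpha> * (2 - \<beta>) * (G / r) * w"
          using wG \<beta> const_bounds G r by (intro mult_left_mono) auto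
        finally show ?thesis using \<beta> by (simp add: mult_ac)
      qed
      then have "((2 - \<alpha>) * G\<^sup>2) * (e \<bullet> v)\<^sup>2 \<le> (\<alpha> * w * (G / r) * (2 - \<beta>)) * (e \<bullet> v)\<^sup>2"
        by (intro mult_right_mono) auto
      then show ?thesis using quad[OF v] unfolding w_def[symmetric]
        by (simp add: algebra_simps diff_divide_distrib add_divide_distrib)
    qed
    have "0 \<le> - (- \<alpha>) * u y powr (- \<theta>) * H e + (- \<alpha> + 2) * (g \<bullet> e)\<^sup>2 - (norm g)\<^sup>2 + c * ?L"
      by (rule touching[OF y _ \<theta>(3)[symmetric] jet min e(1) L]) (use \<theta> in auto)
    also have "\<dots> \<le> \<alpha> * w * (G / r * ((\<beta> - 2) * (e \<bullet> e)\<^sup>2 + 1)) + (2 - \<alpha>) * (G\<^sup>2 * (e \<bullet> e)\<^sup>2) - G\<^sup>2 + E + c * ?L"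
      using quad[OF e(1)] unfolding w_def by (intro add_right_mono)
    also have "\<dots> = - ((\<alpha> - \<beta>) * \<alpha> * (G / r) * w) + (1 + c) * E"
    proof -
      have "e \<bullet> e = 1" using e(1) by (simp add: norm_eq_1)
      then show ?thesis unfolding const_bounds(6)
        by (simp add: algebra_simps diff_divide_distrib add_divide_distrib)
    qed
    also have "\<dots> \<le> - ((\<alpha> - \<beta>) * \<alpha> * (G / r) * (r * G / \<beta>)) + 2 * E"
    proof -
      have "(\<alpha> - \<beta>) * \<alpha> * (G / r) * (r * G / \<beta>) \<le> (\<alpha> - \<beta>) * \<alpha> * (G / r) * w"
        using wG \<beta> const_bounds G r by (intro mult_left_mono) auto
      moreover have "(1 + c) * E \<le> 2 * E"
        using const_bounds G \<epsilon> by (intro mult_right_mono) (auto simp: E_def)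
      ultimately show ?thesis by linarith
    qed
    also have "\<dots> = - (\<delta> * G\<^sup>2) + 2 * E"
      using r by (simp add: \<delta>_def power2_eq_square)
    also have "\<dots> < 0"
    proof -
      have "G * \<epsilon> \<le> G * (G * \<eta>)" using \<epsilon> G by (intro mult_left_mono) auto
      moreover have "\<epsilon>\<^sup>2 \<le> (G * \<eta>)\<^sup>2" using \<epsilon> by (intro power_mono) auto
      moreover have "(G * \<eta>)\<^sup>2 \<le> G\<^sup>2 * \<eta>"
        using \<eta> G mult_left_le[of \<eta> \<eta>] by (simp add: power_mult_distrib power2_eq_square)
      ultimately have "2 * E \<le> 16 * \<eta> * G\<^sup>2"
        by (simp add: E_def power2_eq_square algebra_simps)
      also have "\<dots> < \<delta> * G\<^sup>2" using \<eta>(3) G by (intro mult_strict_right_mono) auto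
      finally show ?thesis by simp
    qed
    finally show False by simp
  qed
qed

text \<open>A function that is differentiable at the origin cannot lie above \<open>u\<^bsup>-\<theta>\<^esup>\<close> with a conical gap \<open>\<epsilon> |x|\<close>
  and yet be approached by \<open>u\<^bsup>-\<theta>\<^esup>\<close> at the origin. Passing to reciprocals turns the cone over: by
  convexity of \<open>1 / t\<close>, \<open>u\<^bsup>\<theta>\<^esup>\<close> lies above an affine function plus a multiple of \<open>|x|\<close>, hence on a small
  sphere above that affine function plus a constant \<open>\<eta>\<close>; the minimum principle carries the constant
  inwards to the origin.\<close>

lemma no_touching_at_puncture:
  assumes S: "0 < S" "S < 2" and h: "h differentiable (at 0)"
    and s: "0 < s + h 0" and \<epsilon>: "0 < \<epsilon>"
    and le: "\<And>x. x \<in> cball 0 S - {0} \<Longrightarrow> u x powr (- \<theta>) - h x \<le> s - \<epsilon> * norm x"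
  obtains s' where "s' < s" "\<And>x. x \<in> cball 0 S - {0} \<Longrightarrow> u x powr (- \<theta>) - h x \<le> s'"
proof -
  define A where "A = s + h 0"
  have A: "0 < A" using s by (simp add: A_def)
  have inv: "u x powr (- \<theta>) = 1 / u x powr \<theta>" for x
    by (simp add: powr_minus_divide)
  have dom: "0 < u x powr \<theta>" if "x \<in> cball 0 S - {0}" for x
    using u_pos[of x] that S by auto
  define B where "B = grad h 0"
  have der: "(h has_derivative (\<lambda>v. B \<bullet> v)) (at 0)"
    unfolding B_def by (rule has_derivative_grad[OF h])
  have "\<exists>d>0. \<forall>x. norm (x - 0) < d \<longrightarrow> norm (h x - h 0 - B \<bullet> (x - 0)) \<le> (\<epsilon> / 2) * norm (x - 0)"
    using der half_gt_zero[OF \<epsilon>] unfolding has_derivative_at_alt by blast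
  then obtain d where d: "0 < d" "\<And>x. norm x < d \<Longrightarrow> \<bar>h x - h 0 - B \<bullet> x\<bar> \<le> \<epsilon> / 2 * norm x"
    by auto
  define \<rho> where "\<rho> = min d S / 2"
  have \<rho>: "0 < \<rho>" "\<rho> < d" "\<rho> < S" using d(1) S by (auto simp: \<rho>_def min_def)
  define \<eta> where "\<eta> = \<epsilon> * \<rho> / (2 * A\<^sup>2)"
  have \<eta>: "0 < \<eta>" using \<epsilon> \<rho> A by (simp add: \<eta>_def)
  have "(1 / A + \<eta>) + (- B /\<^sub>R A\<^sup>2) \<bullet> x \<le> u x powr \<theta>" if x: "x \<noteq> 0" "norm x < \<rho>" for x
  proof (rule affine_minimum_principle[OF \<rho>(1) _ _ x])
    show "\<rho> < 2" using \<rho> S by simp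
    fix x :: "real ^ 'n" assume x: "norm x = \<rho>"
    then have xD: "x \<in> cball 0 S - {0}" using \<rho> by auto
    define t where "t = B \<bullet> x - \<epsilon> / 2 * \<rho>"
    have "\<bar>h x - h 0 - B \<bullet> x\<bar> \<le> \<epsilon> / 2 * \<rho>" "u x powr (- \<theta>) - h x \<le> s - \<epsilon> * \<rho>"
      using d(2)[of x] le[OF xD] x \<rho> by auto
    then have "u x powr (- \<theta>) \<le> A + t"
      unfolding A_def t_def by argo
    then have w: "1 / u x powr \<theta> \<le> A + t" unfolding inv .
    have At: "0 < A + t" using w dom[OF xD] by (smt (verit) divide_pos_pos)
    have "1 / A + \<eta> + (- B /\<^sub>R A\<^sup>2) \<bullet> x = 1 / A - t / A\<^sup>2"
      using A by (simp add: t_def \<eta>_def field_simps)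
    also have "\<dots> \<le> 1 / (A + t)" by (rule reciprocal_ge_tangent[OF A At])
    also have "\<dots> \<le> u x powr \<theta>"
      using w At dom[OF xD] by (simp add: field_simps)
    finally show "1 / A + \<eta> + (- B /\<^sub>R A\<^sup>2) \<bullet> x \<le> u x powr \<theta>" .
  qed
  note low = this
  \<comment> \<open>Near the origin the affine term consumes at most half of the gain \<open>\<eta>\<close>, which leaves
    \<open>u\<^bsup>-\<theta>\<^esup> \<le> A1 < A\<close>; \<open>\<sigma>\<close> is a radius for which this holds and \<open>h\<close> drops by at most half of \<open>A - A1\<close>.\<close>
  define A1 where "A1 = 1 / (1 / A + \<eta> / 2)"
  have A1: "0 < A1" "A1 < A" using A \<eta> by (auto simp: A1_def field_simps add_pos_pos)
  define \<sigma> where "\<sigma> = min \<rho> (min (\<eta> * A\<^sup>2 / (2 * (norm B + 1))) ((A - A1) / (2 * (norm B + \<epsilon>))))"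
  have nB: "0 < norm B + 1" "0 < norm B + \<epsilon>" using \<epsilon> by (auto intro: add_nonneg_pos)
  have cancel: "a * (b / (2 * a)) = b / 2" if "0 < a" for a b :: real
    using that by simp
  have \<sigma>: "0 < \<sigma>" "\<sigma> \<le> \<rho>" "\<sigma> \<le> \<eta> * A\<^sup>2 / (2 * (norm B + 1))" "\<sigma> \<le> (A - A1) / (2 * (norm B + \<epsilon>))"
    using \<rho> \<eta> A A1 nB by (auto simp: \<sigma>_def)
  show ?thesis
  proof (rule that[of "max (s - \<epsilon> * \<sigma>) (s - (A - A1) / 2)"])
    show "max (s - \<epsilon> * \<sigma>) (s - (A - A1) / 2) < s" using \<epsilon> \<sigma> A1 by simp
    fix x :: "real ^ 'n" assume x: "x \<in> cball 0 S - {0}"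
    show "u x powr (- \<theta>) - h x \<le> max (s - \<epsilon> * \<sigma>) (s - (A - A1) / 2)"
    proof (cases "norm x < \<sigma>")
      case False
      then have "\<epsilon> * \<sigma> \<le> \<epsilon> * norm x" using \<epsilon> by (intro mult_left_mono) auto
      then show ?thesis using le[OF x] by simp
    next
      case True
      have Bx: "\<bar>B \<bullet> x\<bar> \<le> norm B * norm x" by (rule Cauchy_Schwarz_ineq2)
      have "\<bar>B \<bullet> x\<bar> \<le> (norm B + 1) * \<sigma>"
        using Bx mult_mono[of "norm B" "norm B + 1" "norm x" \<sigma>] True by auto
      also have "\<dots> \<le> (norm B + 1) * (\<eta> * A\<^sup>2 / (2 * (norm B + 1)))"
        using \<sigma>(3) nB by (intro mult_left_mono) auto
      also have "\<dots> = \<eta> * A\<^sup>2 / 2" by (rule cancel[OF nB(1)])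
      finally have "B \<bullet> x / A\<^sup>2 \<le> \<eta> / 2"
        using A by (simp add: pos_divide_le_eq abs_le_iff)
      then have "1 / A + \<eta> / 2 \<le> u x powr \<theta>"
      proof -
        have "(- B /\<^sub>R A\<^sup>2) \<bullet> x = - (B \<bullet> x / A\<^sup>2)"
          by (simp add: divide_inverse)
        moreover have "1 / A + \<eta> + (- B /\<^sub>R A\<^sup>2) \<bullet> x \<le> u x powr \<theta>"
          using x True \<sigma>(2) by (intro low) auto
        ultimately show ?thesis using \<open>B \<bullet> x / A\<^sup>2 \<le> \<eta> / 2\<close> by linarith
      qed
      then have "1 / u x powr \<theta> \<le> A1"
        unfolding A1_def using A \<eta> by (intro divide_left_mono) (auto intro!: mult_pos_pos add_pos_pos dom[OF x])
      moreover have "h 0 - (A - A1) / 2 \<le> h x"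
      proof -
        have "h 0 - h x \<le> norm B * norm x + \<epsilon> * norm x"
        proof -
          have "\<bar>h x - h 0 - B \<bullet> x\<bar> \<le> \<epsilon> / 2 * norm x"
            using True \<sigma>(2) \<rho>(2) by (intro d(2)) simp
          moreover have "\<epsilon> / 2 * norm x \<le> \<epsilon> * norm x"
            using \<epsilon> by (intro mult_right_mono) auto
          ultimately show ?thesis using Bx by linarith
        qed
        also have "\<dots> \<le> (norm B + \<epsilon>) * \<sigma>"
          using True nB unfolding distrib_right[symmetric] by (intro mult_left_mono) auto
        also have "\<dots> \<le> (norm B + \<epsilon>) * ((A - A1) / (2 * (norm B + \<epsilon>)))"
          using \<sigma>(4) nB by (intro mult_left_mono) auto
        also have "\<dots> = (A - A1) / 2" by (rule cancel[OF nB(2)])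
        finally show ?thesis by argo
      qed
      ultimately have "u x powr (- \<theta>) - h x \<le> A1 - h 0 + (A - A1) / 2" unfolding inv by simp
      also have "\<dots> = s - (A - A1) / 2" by (simp add: A_def field_simps)
      finally show ?thesis by simp
    qed
  qed
qed

text \<open>If no small linear perturbation of \<open>f\<close> has a maximum off the origin, then each of them is
  bounded by the value that \<open>f\<close> approaches at the origin, where all the perturbations vanish.
  Choosing the slope at \<open>x\<close> to point towards the origin yields the conical gap.\<close>

lemma sup_at_puncture:
  fixes f :: "real ^ 'n \<Rightarrow> real"
  assumes cont: "continuous_on (cball 0 S - {0}) f"
    and s: "\<And>x. x \<in> cball 0 S - {0} \<Longrightarrow> f x \<le> s"
    and none: "\<And>y p. y \<in> cball 0 S - {0} \<Longrightarrow> norm p \<le> \<epsilon> \<Longrightarrow> s - \<epsilon> * S \<le> f y \<Longrightarrow>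
      \<exists>x\<in>cball 0 S - {0}. f y - p \<bullet> y < f x - p \<bullet> x"
    and \<epsilon>: "0 < \<epsilon>" and x: "x \<in> cball 0 S - {0}"
  shows "f x \<le> s - \<epsilon> * norm x"
proof -
  define p where "p = (- \<epsilon> / norm x) *\<^sub>R x"
  have p: "norm p \<le> \<epsilon>" using \<epsilon> x by (simp add: p_def)
  have px: "p \<bullet> x = - \<epsilon> * norm x"
    using x by (simp add: p_def dot_square_norm power2_eq_square)
  have pz: "\<bar>p \<bullet> z\<bar> \<le> \<epsilon> * norm z" for z
    using Cauchy_Schwarz_ineq2[of p z] mult_right_mono[OF p, of "norm z"] by simp
  have "f x - p \<bullet> x \<le> s + e" if e: "0 < e" for e
  proof (rule ccontr)
    assume gt: "\<not> f x - p \<bullet> x \<le> s + e"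
    define \<delta> where "\<delta> = e / \<epsilon>"
    have \<delta>: "0 < \<delta>" "\<epsilon> * \<delta> = e" using e \<epsilon> by (auto simp: \<delta>_def)
    have near: "f z - p \<bullet> z \<le> s + e" if z: "z \<in> cball 0 S - {0}" "norm z < \<delta>" for z
    proof -
      have "\<epsilon> * norm z \<le> e" using z(2) \<epsilon> \<delta>(2) by (metis less_imp_le mult_left_mono)
      then show ?thesis using s[OF z(1)] pz[of z] by linarith
    qed
    let ?K = "cball 0 S - ball 0 \<delta> :: (real ^ 'n) set"
    have "compact ?K" by (intro compact_diff) auto
    moreover have xK: "x \<in> ?K" using near[OF x] gt x by auto
    moreover have "continuous_on ?K (\<lambda>z. f z - p \<bullet> z)"
      by (intro continuous_intros continuous_on_subset[OF cont]) (use \<delta> in auto)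
    ultimately obtain y where y: "y \<in> ?K" "\<And>z. z \<in> ?K \<Longrightarrow> f z - p \<bullet> z \<le> f y - p \<bullet> y"
      using continuous_attains_sup[of ?K "\<lambda>z. f z - p \<bullet> z"] by blast
    have yD: "y \<in> cball 0 S - {0}" using y(1) \<delta> by auto
    have fy: "s + e < f y - p \<bullet> y" using y(2)[OF xK] gt by simp
    have glob: "f z - p \<bullet> z \<le> f y - p \<bullet> y" if "z \<in> cball 0 S - {0}" for z
      using y(2)[of z] near[OF that] fy that by (cases "norm z < \<delta>") auto
    have "\<epsilon> * norm y \<le> \<epsilon> * S" using yD \<epsilon> by (intro mult_left_mono) auto
    then have "s - \<epsilon> * S \<le> f y" using fy pz[of y] e by linarith
    then obtain z where "z \<in> cball 0 S - {0}" "f y - p \<bullet> y < f z - p \<bullet> z"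
      using none[OF yD p] by blast
    then show False using glob[of z] by simp
  qed
  then have "f x - p \<bullet> x \<le> s" by (rule field_le_epsilon)
  then show ?thesis using px by simp
qed

text \<open>The comparison with the profiles extends across the puncture. If \<open>u\<^bsup>-\<theta>\<^esup>\<close> exceeded the profile
  somewhere, the excess would have a positive supremum. It is not a maximum off the origin, not
  even after small linear perturbations, so it is approached only at the origin and with a conical
  gap; but this is impossible as well.\<close>

lemma radial_comparison:
  assumes S: "S < 2" and d: "0 < d" and x0: "x0 \<noteq> 0" "norm x0 \<le> S - d"
    and W: "0 < W" "\<And>x. x \<in> cball 0 S - {0} \<Longrightarrow> u x powr (- \<theta>) \<le> W"
    and \<beta>: "0 < \<beta>" "\<beta> < \<alpha>" and x: "x \<in> cball 0 S - {0}"
  shows "u x powr (- \<theta>) \<le> u x0 powr (- \<theta>) + W * (norm (x - x0) / d) powr \<beta>"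
proof -
  have S0: "0 < S" using d x0 norm_ge_zero[of x0] by linarith
  define a where "a = u x0 powr (- \<theta>)"
  define b where "b = W / d powr \<beta>"
  have b: "0 < b" using W d by (simp add: b_def)
  define h where "h z = a + b * norm (z - x0) powr \<beta>" for z
  define f where "f z = u z powr (- \<theta>) - h z" for z
  let ?D = "cball 0 S - {0} :: (real ^ 'n) set"
  have Dsub: "?D \<subseteq> ball 0 2 - {0}" using S by auto
  have "f x \<le> 0"
  proof (rule ccontr)
    assume fx: "\<not> f x \<le> 0"
    define s where "s = Sup (f ` ?D)"
    have h0: "a \<le> h z" "0 \<le> h z" for z using b by (auto simp: h_def a_def)
    have bdd: "bdd_above (f ` ?D)"
    proof (rule bdd_aboveI2)
      show "f z \<le> W" if "z \<in> ?D" for z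
        using W(2)[OF that] h0(2)[of z] by (simp add: f_def)
    qed
    have fs: "f z \<le> s" if "z \<in> ?D" for z
      unfolding s_def using bdd that by (intro cSup_upper) auto
    have s: "0 < s" using fs[OF x] fx by simp
    have a0: "0 \<le> a" by (simp add: a_def)
    obtain \<epsilon>0 where \<epsilon>0: "0 < \<epsilon>0"
      "\<And>y x0 p. y \<in> ball 0 2 - {0} \<Longrightarrow> norm x0 \<le> 2 \<Longrightarrow> y \<noteq> x0 \<Longrightarrow> norm p \<le> \<epsilon>0 \<Longrightarrow>
         a + b * norm (y - x0) powr \<beta> \<le> u y powr (- \<theta>) \<Longrightarrow>
         \<not> (\<forall>\<^sub>F x in nhds y. u x powr (- \<theta>) - (a + b * norm (x - x0) powr \<beta> + p \<bullet> x) \<le>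
            u y powr (- \<theta>) - (a + b * norm (y - x0) powr \<beta> + p \<bullet> y))"
      by (rule no_perturbed_touching[OF \<beta> b a0]) (rule that)
    \<comment> \<open>A perturbation of size at most \<open>s / 2\<close> leaves \<open>f\<close> positive at a perturbed maximum, which
      keeps it away from \<open>x0\<close> and from the outer sphere.\<close>
    define \<epsilon> where "\<epsilon> = min \<epsilon>0 (s / (2 * S))"
    have \<epsilon>: "0 < \<epsilon>" "\<epsilon> \<le> \<epsilon>0" "\<epsilon> * S \<le> s / 2"
    proof -
      show "0 < \<epsilon>" "\<epsilon> \<le> \<epsilon>0" using \<epsilon>0 s S0 by (auto simp: \<epsilon>_def)
      have "\<epsilon> * S \<le> s / (2 * S) * S" using S0 by (intro mult_right_mono) (auto simp: \<epsilon>_def)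
      then show "\<epsilon> * S \<le> s / 2" using S0 by simp
    qed
    have "f z \<le> s - \<epsilon> * norm z" if z: "z \<in> ?D" for z
    proof (rule sup_at_puncture[OF _ fs _ \<epsilon>(1) z])
      show "continuous_on ?D f"
        unfolding f_def h_def using \<beta>
        by (intro continuous_intros continuous_on_u_powr Dsub continuous_on_powr') auto
      fix y p :: "real ^ 'n" assume y: "y \<in> ?D" and p: "norm p \<le> \<epsilon>" and fy: "s - \<epsilon> * S \<le> f y"
      have fy0: "0 < f y" using fy \<epsilon>(3) s by linarith
      have yx0: "y \<noteq> x0" using fy0 by (auto simp: f_def h_def a_def)
      have yS: "norm y < S"
      proof (rule ccontr)
        assume "\<not> norm y < S"
        then have "d \<le> norm (y - x0)"
          using x0(2) norm_triangle_ineq2[of y x0] by linarith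
        then have "d powr \<beta> \<le> norm (y - x0) powr \<beta>" using d \<beta> by (intro powr_mono2) auto
        then have "b * d powr \<beta> \<le> b * norm (y - x0) powr \<beta>" using b by (intro mult_left_mono) auto
        then have "W \<le> h y" using d by (simp add: h_def b_def a_def add_increasing)
        then show False using W(2)[OF y] fy0 by (simp add: f_def)
      qed
      show "\<exists>z\<in>?D. f y - p \<bullet> y < f z - p \<bullet> z"
      proof (rule ccontr)
        assume "\<not> ?thesis"
        then have glob: "f z - p \<bullet> z \<le> f y - p \<bullet> y" if "z \<in> ?D" for z
          using that by (force simp: not_less)
        have "open (ball 0 S - {0} :: (real ^ 'n) set)" by (intro open_Diff) auto
        then have "\<forall>\<^sub>F z in nhds y. z \<in> ball 0 S - {0}"
          using y yS by (intro eventually_nhds_in_open) auto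
        then have "\<forall>\<^sub>F z in nhds y. u z powr (- \<theta>) - (a + b * norm (z - x0) powr \<beta> + p \<bullet> z) \<le>
            u y powr (- \<theta>) - (a + b * norm (y - x0) powr \<beta> + p \<bullet> y)"
        proof eventually_elim
          case (elim z)
          then have "f z - p \<bullet> z \<le> f y - p \<bullet> y" by (intro glob) auto
          then show ?case unfolding f_def h_def by linarith
        qed
        moreover have "a + b * norm (y - x0) powr \<beta> \<le> u y powr (- \<theta>)"
          using fy0 by (simp add: f_def h_def)
        moreover have "norm x0 \<le> 2" using x0 S d by linarith
        moreover have "norm p \<le> \<epsilon>0" using p \<epsilon>(2) by simp
        moreover have "y \<in> ball 0 2 - {0}" using y Dsub by blast
        ultimately show False using \<epsilon>0(2)[of y x0 p] yx0 by blast
      qed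
    qed
    note fz = this
    have hd: "h differentiable (at 0)"
    proof -
      have "norm differentiable (at (0 - x0))"
        using x0(1) by (intro differentiable_norm_at) simp
      moreover have "(\<lambda>x. x - x0) differentiable (at 0)"
        by (intro derivative_intros)
      ultimately have "(norm \<circ> (\<lambda>x. x - x0)) differentiable (at 0)"
        by (intro differentiable_chain_at) auto
      then obtain D where D: "((\<lambda>x. norm (x - x0)) has_derivative D) (at 0)"
        by (auto simp: differentiable_def o_def)
      show ?thesis
        unfolding h_def differentiable_def using x0(1)
        by (intro exI) (auto intro!: derivative_eq_intros D)
    qed
    have sh: "0 < s + h 0" using s h0(2)[of 0] by linarith
    obtain s' where s': "s' < s" "\<And>z. z \<in> ?D \<Longrightarrow> u z powr (- \<theta>) - h z \<le> s'"
      by (rule no_touching_at_puncture[OF S0 S hd sh \<epsilon>(1)], rule fz[unfolded f_def],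
        assumption, rule that)
    have "s \<le> s'" unfolding s_def f_def by (rule cSup_least; use x s'(2) in blast)
    then show False using s'(1) by simp
  qed
  then show ?thesis
    using d by (simp add: f_def h_def a_def b_def powr_divide)
qed

lemma one_sided_holder:
  assumes S: "S < 2" and d: "0 < d" and x0: "x0 \<noteq> 0" "norm x0 \<le> S - d"
    and W: "0 < W" "\<And>x. x \<in> cball 0 S - {0} \<Longrightarrow> u x powr (- \<theta>) \<le> W"
    and x: "x \<in> cball 0 S - {0}"
  shows "u x powr (- \<theta>) \<le> u x0 powr (- \<theta>) + W * (norm (x - x0) / d) powr \<alpha>"
proof (cases "x = x0")
  case False
  have "((\<lambda>\<beta>. u x0 powr (- \<theta>) + W * (norm (x - x0) / d) powr \<beta>) \<longlongrightarrow>
      u x0 powr (- \<theta>) + W * (norm (x - x0) / d) powr \<alpha>) (at_left \<alpha>)"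
    using False d by (intro tendsto_intros) auto
  moreover have "\<forall>\<^sub>F \<beta> in at_left \<alpha>. u x powr (- \<theta>) \<le> u x0 powr (- \<theta>) + W * (norm (x - x0) / d) powr \<beta>"
    using eventually_at_left_real[OF const_bounds(4)]
    by eventually_elim (rule radial_comparison[OF S d x0 W _ _ x], auto)
  ultimately show ?thesis
    using tendsto_lowerbound[of _ _ "at_left \<alpha>"] by fastforce
qed simp

end

section \<open>Hoelder continuity and isolated points\<close>

lemma powr_diff_le:
  fixes a b q M :: real
  assumes "0 < a" "0 < b" and M: "\<And>z. min a b \<le> z \<Longrightarrow> z \<le> max a b \<Longrightarrow> \<bar>q\<bar> * z powr (q - 1) \<le> M"
  shows "\<bar>a powr q - b powr q\<bar> \<le> M * \<bar>a - b\<bar>"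
  using assms
proof (induction a b rule: linorder_wlog)
  case (le a b)
  show ?case
  proof (cases "a = b")
    case False
    then have "a < b" using le by simp
    have "((\<lambda>z. z powr q) has_real_derivative q * z powr (q - 1)) (at z)" if "a \<le> z" for z
      using that le(2) by (intro has_real_derivative_powr) simp
    then obtain z where z: "a < z" "z < b" "b powr q - a powr q = (b - a) * (q * z powr (q - 1))"
      using MVT2[OF \<open>a < b\<close>, of "\<lambda>z. z powr q" "\<lambda>z. q * z powr (q - 1)"] by blast
    have "\<bar>b powr q - a powr q\<bar> = \<bar>b - a\<bar> * (\<bar>q\<bar> * z powr (q - 1))"
      by (simp add: z(3) abs_mult)
    also have "\<dots> \<le> \<bar>b - a\<bar> * M"
      using z le(1) by (intro mult_left_mono le(4)) auto
    finally show ?thesis by (simp add: abs_minus_commute mult.commute)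
  qed simp
next
  case (sym a b)
  then show ?case by (simp add: abs_minus_commute min.commute max.commute)
qed

lemma holder_norm_le:
  assumes "\<And>x. x \<in> S \<Longrightarrow> \<bar>f x\<bar> \<le> M"
    and "\<And>x y. x \<in> S \<Longrightarrow> y \<in> S \<Longrightarrow> \<bar>f x - f y\<bar> \<le> K * dist x y powr \<alpha>"
    and "0 \<le> M" "0 \<le> K"
  shows "holder_norm \<alpha> S f \<le> ennreal (M + K)"
proof -
  have "(SUP x\<in>S. ennreal \<bar>f x\<bar>) \<le> ennreal M"
    using assms(1) by (intro SUP_least ennreal_leI)
  moreover have "(SUP x\<in>S. SUP y\<in>S - {x}. ennreal (\<bar>f x - f y\<bar> / dist x y powr \<alpha>)) \<le> ennreal K"
    using assms(2) by (intro SUP_least ennreal_leI) (auto simp: pos_divide_le_eq)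
  ultimately show ?thesis
    unfolding holder_norm_def using assms(3,4) by (simp add: ennreal_plus add_mono)
qed

lemma holder_space_memI:
  assumes "\<And>x. x \<in> S \<Longrightarrow> \<bar>f x\<bar> \<le> M"
    and "\<And>x y. x \<in> S \<Longrightarrow> y \<in> S \<Longrightarrow> \<bar>f x - f y\<bar> \<le> K * dist x y powr \<alpha>"
    and "0 \<le> M" "0 \<le> K"
  shows "f \<in> holder_space \<alpha> S"
proof -
  have "holder_norm \<alpha> S f \<le> ennreal (M + K)"
    by (rule holder_norm_le[OF assms])
  then have "holder_norm \<alpha> S f < \<infinity>" by (rule le_less_trans) simp
  then show ?thesis by (simp add: holder_space_def)
qed

lemma holder_imp_uniformly_continuous:
  fixes f :: "'a::metric_space \<Rightarrow> real"
  assumes "\<And>x y. x \<in> S \<Longrightarrow> y \<in> S \<Longrightarrow> \<bar>f x - f y\<bar> \<le> K * dist x y powr \<alpha>" "0 < \<alpha>" "0 \<le> K"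
  shows "uniformly_continuous_on S f"
  unfolding uniformly_continuous_on_def
proof (intro allI impI)
  fix e :: real assume e: "0 < e"
  define d where "d = (e / (K + 1)) powr (1 / \<alpha>)"
  have d: "0 < d" "d powr \<alpha> = e / (K + 1)"
    using e assms(2,3) by (auto simp: d_def powr_powr)
  show "\<exists>d>0. \<forall>x\<in>S. \<forall>x'\<in>S. dist x' x < d \<longrightarrow> dist (f x') (f x) < e"
  proof (intro exI[of _ d] conjI ballI impI d(1))
    fix x x' assume x: "x \<in> S" "x' \<in> S" "dist x' x < d"
    have "\<bar>f x' - f x\<bar> \<le> K * dist x' x powr \<alpha>" using assms(1) x by blast
    also have "\<dots> \<le> K * d powr \<alpha>"
      using x assms by (intro mult_left_mono powr_mono2) auto
    also have "\<dots> < e" unfolding d(2) using e assms(3) by (simp add: field_simps)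
    finally show "dist (f x') (f x) < e" by (simp add: dist_real_def)
  qed
qed

lemma holder_puncture_limit:
  fixes f :: "'a::{perfect_space, real_normed_vector} \<Rightarrow> real"
  assumes "\<And>x y. x \<in> ball 0 R - {0} \<Longrightarrow> y \<in> ball 0 R - {0} \<Longrightarrow> \<bar>f x - f y\<bar> \<le> K * dist x y powr \<alpha>"
    and "0 < \<alpha>" "0 \<le> K" "0 < R"
  obtains L where "(f \<longlongrightarrow> L) (at 0)"
proof -
  have "(0 :: 'a) islimpt ball 0 R"
    using assms(4) by (intro interior_limit_point) auto
  then have "0 \<in> closure (ball 0 R - {0} :: 'a set)" by (simp add: islimpt_in_closure)
  moreover have "uniformly_continuous_on (ball 0 R - {0}) f"
    by (rule holder_imp_uniformly_continuous[OF assms(1-3)])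
  ultimately obtain L where L: "(f \<longlongrightarrow> L) (at 0 within ball 0 R - {0})"
    using uniformly_continuous_on_extension_at_closure by blast
  have "at (0 :: 'a) within ball 0 R - {0} = at 0"
    using at_within_nhd[of "0 :: 'a" "ball 0 R" "ball 0 R - {0}" UNIV] assms(4) by auto
  then show ?thesis using L that by simp
qed

lemma holder_extend:
  fixes f :: "'a::{perfect_space, real_normed_vector} \<Rightarrow> real"
  assumes f: "\<And>x y. x \<in> ball 0 R - {0} \<Longrightarrow> y \<in> ball 0 R - {0} \<Longrightarrow> \<bar>f x - f y\<bar> \<le> K * dist x y powr \<alpha>"
    and "0 < \<alpha>" "0 < R" and L: "(f \<longlongrightarrow> L) (at 0)"
    and xy: "x \<in> ball 0 R" "y \<in> ball 0 R"
  shows "\<bar>(f(0 := L)) x - (f(0 := L)) y\<bar> \<le> K * dist x y powr \<alpha>"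
proof -
  have one: "\<bar>f x - L\<bar> \<le> K * dist x 0 powr \<alpha>" if x: "x \<in> ball 0 R - {0}" for x
  proof (rule tendsto_le[of "at (0 :: 'a)"])
    show "((\<lambda>y. K * dist x y powr \<alpha>) \<longlongrightarrow> K * dist x 0 powr \<alpha>) (at 0)"
      using x by (intro tendsto_intros) auto
    show "((\<lambda>y. \<bar>f x - f y\<bar>) \<longlongrightarrow> \<bar>f x - L\<bar>) (at 0)"
      by (intro tendsto_intros L)
    have "\<forall>\<^sub>F y in at 0. y \<in> ball 0 R - {0 :: 'a}"
      using assms(3) by (intro eventually_at_in_open) auto
    then show "\<forall>\<^sub>F y in at 0. \<bar>f x - f y\<bar> \<le> K * dist x y powr \<alpha>"
      by eventually_elim (use f x in blast)
  qed simp
  consider "x = 0" "y = 0" | "x = 0" "y \<noteq> 0" | "x \<noteq> 0" "y = 0" | "x \<noteq> 0" "y \<noteq> 0" by blast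
  then show ?thesis
  proof cases
    case 2
    then show ?thesis using one[of y] xy by (simp add: abs_minus_commute)
  next
    case 3
    then show ?thesis using one[of x] xy by simp
  next
    case 4
    then show ?thesis using f[of x y] xy by simp
  qed simp
qed

section \<open>Hoelder continuity across the puncture and the dichotomy\<close>

context admissible
begin

lemma minimum_principle:
  assumes \<rho>: "0 < \<rho>" "\<rho> < 2" and m: "0 < m" "\<And>x. norm x = \<rho> \<Longrightarrow> m \<le> u x"
    and x: "x \<in> cball 0 \<rho> - {0}"
  shows "m \<le> u x"
proof (cases "norm x = \<rho>")
  case False
  have "m powr \<theta> + 0 \<bullet> x \<le> u x powr \<theta>"
  proof (rule affine_minimum_principle[OF \<rho>])
    show "m powr \<theta> + 0 \<bullet> z \<le> u z powr \<theta>" if "norm z = \<rho>" for z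
      using m(1) m(2)[OF that] \<theta>(1) by (simp add: powr_mono2)
  qed (use x False in auto)
  then have "m powr \<theta> \<le> u x powr \<theta>" by simp
  moreover have "0 < u x" using u_pos[of x] x \<rho> by auto
  ultimately show ?thesis
    using m(1) \<theta>(1) powr_less_mono2[of \<theta> "u x" m] by (meson less_imp_le not_le)
qed (use m in auto)

definition \<xi> where "\<xi> x = u x powr (- 2 / (N - 2))"

lemma \<xi>_le:
  assumes "0 < m" "m \<le> u x"
  shows "\<xi> x \<le> m powr (- 2 / (N - 2))"
  unfolding \<xi>_def using assms const_bounds(1) by (intro powr_mono2') (auto simp: divide_le_0_iff)

text \<open>The one-sided bounds with \<open>x\<close> and \<open>y\<close> in both roles make \<open>u\<^bsup>-\<theta>\<^esup>\<close> Hoelder continuous, and \<open>\<xi>\<close> is its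
  power with exponent \<open>2 / \<alpha> \<ge> 1\<close>. The homogeneity in \<open>u\<close> survives, so that the constant is linear in
  \<open>m\<^bsup>-2/(n-2)\<^esup>\<close>.\<close>

lemma \<xi>_holder:
  assumes S: "S < 2" and d: "0 < d" "d < S"
    and m: "0 < m" "\<And>x. norm x = S \<Longrightarrow> m \<le> u x"
    and xy: "x \<in> cball 0 (S - d) - {0}" "y \<in> cball 0 (S - d) - {0}"
  shows "\<bar>\<xi> x - \<xi> y\<bar> \<le> 2 / \<alpha> / d powr \<alpha> * m powr (- 2 / (N - 2)) * dist x y powr \<alpha>"
proof -
  define w where "w z = u z powr (- \<theta>)" for z
  define W where "W = m powr (- \<theta>)"
  have W: "0 < W" using m by (simp add: W_def)
  have wW: "w z \<le> W" if z: "z \<in> cball 0 S - {0}" for z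
    unfolding w_def W_def using minimum_principle[OF _ S m z] m(1) \<theta>(1) d
    by (intro powr_mono2') auto
  have wpos: "0 < w z" if "z \<in> cball 0 S - {0}" for z
    using u_pos[of z] that S by (auto simp: w_def)
  have sub: "z \<in> cball 0 S - {0}" if "z \<in> cball 0 (S - d) - {0}" for z
    using that d by auto
  have os: "w a - w b \<le> W * (dist x y / d) powr \<alpha>"
    if "a \<in> cball 0 (S - d) - {0}" "b \<in> cball 0 (S - d) - {0}" "dist a b = dist x y" for a b
    using one_sided_holder[OF S d(1) _ _ W, of b a] wW that(1,2) sub[OF that(1)]
    by (simp add: w_def dist_norm[of a b, symmetric] that(3))
  have wxy: "\<bar>w x - w y\<bar> \<le> W * (dist x y / d) powr \<alpha>"
    using os[OF xy] os[OF xy(2,1)] by (simp add: dist_commute abs_le_iff)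
  have \<alpha>: "0 < \<alpha>" "\<alpha> \<le> 1" using const_bounds by auto
  have ex: "- \<theta> * (2 / \<alpha>) = - 2 / (N - 2)" using \<alpha> by (simp add: \<theta>_def)
  have \<xi>w: "\<xi> z = w z powr (2 / \<alpha>)" for z
    unfolding \<xi>_def w_def powr_powr ex ..
  have "\<bar>\<xi> x - \<xi> y\<bar> \<le> 2 / \<alpha> * W powr (2 / \<alpha> - 1) * \<bar>w x - w y\<bar>"
    unfolding \<xi>w
  proof (rule powr_diff_le)
    show "0 < w x" "0 < w y" using wpos sub xy by blast+
    fix z assume z: "min (w x) (w y) \<le> z" "z \<le> max (w x) (w y)"
    have "0 < z" using z(1) \<open>0 < w x\<close> \<open>0 < w y\<close> by (auto simp: min_def split: if_splits)
    moreover have "z \<le> W" using z(2) wW[OF sub[OF xy(1)]] wW[OF sub[OF xy(2)]] by simp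
    moreover have "0 \<le> 2 / \<alpha> - 1" using \<alpha> by (simp add: field_simps)
    ultimately have "z powr (2 / \<alpha> - 1) \<le> W powr (2 / \<alpha> - 1)" by (intro powr_mono2) auto
    then show "\<bar>2 / \<alpha>\<bar> * z powr (2 / \<alpha> - 1) \<le> 2 / \<alpha> * W powr (2 / \<alpha> - 1)"
      using \<alpha> by (simp add: divide_right_mono)
  qed
  also have "\<dots> \<le> 2 / \<alpha> * W powr (2 / \<alpha> - 1) * (W * (dist x y / d) powr \<alpha>)"
    using wxy \<alpha> by (intro mult_left_mono) auto
  also have "\<dots> = 2 / \<alpha> * (W powr (2 / \<alpha> - 1) * W) * (dist x y powr \<alpha> / d powr \<alpha>)"
    using d by (simp add: powr_divide)
  also have "W powr (2 / \<alpha> - 1) * W = m powr (- 2 / (N - 2))"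
  proof -
    have "W powr (2 / \<alpha> - 1) * W = W powr (2 / \<alpha>)" using W by (simp add: powr_diff)
    then show ?thesis unfolding W_def powr_powr ex .
  qed
  finally show ?thesis by (simp add: mult_ac)
qed

lemma sphere_minimum:
  assumes "0 < \<rho>" "\<rho> < 2"
  shows "0 < (INF x\<in>sphere 0 \<rho>. u x)" "\<And>x. norm x = \<rho> \<Longrightarrow> (INF x\<in>sphere 0 \<rho>. u x) \<le> u x"
proof -
  have "sphere 0 \<rho> \<subseteq> ball 0 2 - {0 :: real ^ 'n}" using assms by auto
  then have cont: "continuous_on (sphere 0 \<rho>) u" and pos: "\<And>x. x \<in> sphere 0 \<rho> \<Longrightarrow> 0 < u x"
    using continuous_on_subset[OF continuous_on_u] u_pos by blast+
  have ne: "sphere 0 \<rho> \<noteq> ({} :: (real ^ 'n) set)" using assms by simp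
  obtain z where z: "z \<in> sphere 0 \<rho>" "\<And>x. x \<in> sphere 0 \<rho> \<Longrightarrow> u z \<le> u x"
    using continuous_attains_inf[OF compact_sphere ne cont] by blast
  have "(INF x\<in>sphere 0 \<rho>. u x) = u z"
    using z by (intro cInf_eq_minimum) auto
  then show "0 < (INF x\<in>sphere 0 \<rho>. u x)" "\<And>x. norm x = \<rho> \<Longrightarrow> (INF x\<in>sphere 0 \<rho>. u x) \<le> u x"
    using z pos by auto
qed

text \<open>The only place where the dependence on \<open>k\<close> has to be removed from a constant: \<open>2k - n\<close> is a
  positive integer, so \<open>\<alpha> \<ge> 1 / k\<close>.\<close>

lemma holder_const_le: "2 / \<alpha> / (1 / 2) powr \<alpha> \<le> 4 * N"
proof -
  have "1 \<le> 2 * real k - N"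
  proof -
    have "CARD('n) < 2 * k" using k_gt by linarith
    then show ?thesis unfolding N_def by linarith
  qed
  then have "2 / \<alpha> \<le> 2 * real k / 1"
    unfolding \<alpha>_def using k_pos by (simp add: divide_le_eq mult_left_le)
  also have "\<dots> \<le> 2 * N" using k_le by (simp add: N_def)
  finally have 1: "2 / \<alpha> \<le> 2 * N" .
  have "(1 / 2 :: real) powr 1 \<le> (1 / 2) powr \<alpha>"
    using const_bounds by (intro powr_mono') auto
  then have "2 / \<alpha> / (1 / 2) powr \<alpha> \<le> 2 / \<alpha> / (1 / 2)"
    using const_bounds by (intro divide_left_mono) auto
  then show ?thesis using 1 by simp
qed

text \<open>The dichotomy is whether the limit \<open>L\<close> of \<open>\<xi>\<close> at the origin is positive. If it is, \<open>\<xi>\<close> is bounded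
  away from \<open>0\<close> and \<open>u\<close>, a negative power of it, inherits its regularity. If \<open>L = 0\<close>, the Hoelder bound
  between \<open>x\<close> and the origin is itself the growth estimate.\<close>

lemma holder_extension_and_dichotomy:
  defines "C0 \<equiv> 1 + 4 * N" and "m \<equiv> (INF x\<in>sphere 0 1. u x)"
  shows "(\<exists>\<xi>'. (\<forall>x\<in>ball 0 1 - {0}. \<xi>' x = \<xi> x) \<and> \<xi>' \<in> holder_space \<alpha> (ball 0 1) \<and>
           holder_norm \<alpha> (ball 0 (1/2)) \<xi>' \<le> ennreal (C0 * m powr (- 2 / (N - 2)))) \<and>
        ((0 < (INF x\<in>ball 0 1 - {0}. ereal (u x)) \<and>
         (INF x\<in>ball 0 1 - {0}. ereal (u x)) \<le> (SUP x\<in>ball 0 1 - {0}. ereal (u x)) \<and>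
         (SUP x\<in>ball 0 1 - {0}. ereal (u x)) < \<infinity> \<and>
         (\<exists>u'. (\<forall>x\<in>ball 0 1 - {0}. u' x = u x) \<and> u' \<in> holder_space \<alpha> (ball 0 1)))
         \<or>
         (\<forall>x. 0 < norm x \<and> norm x < 1/2 \<longrightarrow>
              norm x powr ((N - 2) / 2 * \<alpha>) * u x \<ge> m / C0 powr ((N - 2) / 2)))"
proof -
  let ?p = "- 2 / (N - 2)" and ?q = "- ((N - 2) / 2)"
  have N2: "0 < N - 2" and \<alpha>: "0 < \<alpha>" "\<alpha> \<le> 1" using const_bounds by auto
  have m: "0 < m" "\<And>x. norm x = 1 \<Longrightarrow> m \<le> u x"
    unfolding m_def using sphere_minimum[of 1] by auto
  define M where "M = m powr ?p"
  have M: "0 < M" using m by (simp add: M_def)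
  \<comment> \<open>Hoelder continuity up to the unit sphere comes from estimates inside a larger
    sphere.\<close>
  define m2 where "m2 = (INF x\<in>sphere 0 (3/2). u x)"
  have m2: "0 < m2" "\<And>x. norm x = 3/2 \<Longrightarrow> m2 \<le> u x"
    unfolding m2_def using sphere_minimum[of "3/2"] by auto
  define K2 where "K2 = 2 / \<alpha> / (1/4) powr \<alpha> * m2 powr ?p"
  have K2: "0 \<le> K2" using \<alpha> by (simp add: K2_def)
  have hol2: "\<bar>\<xi> x - \<xi> y\<bar> \<le> K2 * dist x y powr \<alpha>"
    if "x \<in> ball 0 (5/4) - {0}" "y \<in> ball 0 (5/4) - {0}" for x y
    unfolding K2_def by (rule \<xi>_holder[where S = "3/2", OF _ _ _ m2]) (use that in auto)
  have hol1: "\<bar>\<xi> x - \<xi> y\<bar> \<le> 4 * N * M * dist x y powr \<alpha>"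
    if "x \<in> ball 0 (1/2) - {0}" "y \<in> ball 0 (1/2) - {0}" for x y
  proof -
    have "\<bar>\<xi> x - \<xi> y\<bar> \<le> 2 / \<alpha> / (1/2) powr \<alpha> * M * dist x y powr \<alpha>"
      unfolding M_def by (rule \<xi>_holder[where S = 1, OF _ _ _ m]) (use that in auto)
    also have "\<dots> \<le> 4 * N * M * dist x y powr \<alpha>"
      using holder_const_le M by (intro mult_right_mono) auto
    finally show ?thesis .
  qed
  obtain L where L: "(\<xi> \<longlongrightarrow> L) (at 0)"
    using holder_puncture_limit[where R = "5/4", OF hol2 \<alpha>(1) K2] by auto
  define X where "X = \<xi>(0 := L)"
  have X: "\<And>x. x \<noteq> 0 \<Longrightarrow> X x = \<xi> x" "X 0 = L" by (auto simp: X_def)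
  have Xhol2: "\<bar>X x - X y\<bar> \<le> K2 * dist x y powr \<alpha>" if "x \<in> ball 0 (5/4)" "y \<in> ball 0 (5/4)" for x y
    unfolding X_def by (rule holder_extend[where R = "5/4", OF hol2 \<alpha>(1) _ L that]) auto
  have Xhol1: "\<bar>X x - X y\<bar> \<le> 4 * N * M * dist x y powr \<alpha>" if "x \<in> ball 0 (1/2)" "y \<in> ball 0 (1/2)" for x y
    unfolding X_def by (rule holder_extend[where R = "1/2", OF hol1 \<alpha>(1) _ L that]) auto
  have ulow: "m \<le> u x" if "x \<in> cball 0 1 - {0}" for x
    using minimum_principle[OF _ _ m that] by simp
  have upos: "0 < u x" if "x \<in> cball 0 1 - {0}" for x
    using ulow[OF that] m(1) by simp
  have \<xi>pos: "0 < \<xi> x" if "x \<in> cball 0 1 - {0}" for x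
    using upos[OF that] by (simp add: \<xi>_def)
  have \<xi>M: "\<xi> x \<le> M" if "x \<in> cball 0 1 - {0}" for x
    unfolding M_def by (rule \<xi>_le[OF m(1) ulow[OF that]])
  have near: "\<forall>\<^sub>F x in at 0. x \<in> ball 0 1 - {0 :: real ^ 'n}"
    by (intro eventually_at_in_open) auto
  have L0: "0 \<le> L"
    by (rule tendsto_lowerbound[OF L]) (auto simp: \<xi>_def)
  have "\<forall>\<^sub>F x in at 0. \<xi> x \<le> M"
    using near by eventually_elim (rule \<xi>M, auto)
  then have "L \<le> M" by (intro tendsto_upperbound[OF L]) auto
  then have XM: "\<bar>X x\<bar> \<le> M" if "x \<in> ball 0 1" for x
    using that L0 \<xi>M[of x] \<xi>pos[of x] by (cases "x = 0") (auto simp: X)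
  have Xsp: "X \<in> holder_space \<alpha> (ball 0 1)"
    by (rule holder_space_memI[OF XM Xhol2]) (use M K2 in auto)
  have Xn: "holder_norm \<alpha> (ball 0 (1/2)) X \<le> ennreal (C0 * m powr ?p)"
  proof -
    have "holder_norm \<alpha> (ball 0 (1/2)) X \<le> ennreal (M + 4 * N * M)"
      by (rule holder_norm_le[OF XM Xhol1]) (use M const_bounds(1) in auto)
    then show ?thesis by (simp add: C0_def M_def algebra_simps)
  qed
  have u\<xi>: "u x = \<xi> x powr ?q" if "x \<in> cball 0 1 - {0}" for x
  proof -
    have "?p * ?q = 1" using N2 by (simp add: field_simps)
    then show ?thesis unfolding \<xi>_def powr_powr using upos[OF that] by (simp only: powr_one)
  qed
  have "(\<forall>x. 0 < norm x \<and> norm x < 1/2 \<longrightarrow> norm x powr ((N - 2) / 2 * \<alpha>) * u x \<ge> m / C0 powr ((N - 2) / 2))"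
    if "L = 0"
  proof (intro allI impI)
    fix x :: "real ^ 'n" assume x: "0 < norm x \<and> norm x < 1/2"
    then have x1: "x \<in> cball 0 1 - {0}" by auto
    have "\<xi> x \<le> 4 * N * M * norm x powr \<alpha>"
      using Xhol1[of x 0] x X that by simp
    also have "\<dots> \<le> C0 * M * norm x powr \<alpha>"
      using M by (intro mult_right_mono) (auto simp: C0_def)
    finally have "(C0 * M * norm x powr \<alpha>) powr ?q \<le> \<xi> x powr ?q"
      using \<xi>pos[OF x1] N2 by (intro powr_mono2') auto
    moreover have "0 < C0" using const_bounds(1) by (simp add: C0_def)
    then have "(C0 * M * norm x powr \<alpha>) powr ?q = C0 powr ?q * M powr ?q * norm x powr (\<alpha> * ?q)"
      using M by (simp add: powr_mult powr_powr)
    moreover have "M powr ?q = m"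
    proof -
      have "?p * ?q = 1" using N2 by (simp add: field_simps)
      then show ?thesis unfolding M_def powr_powr using m(1) by (simp only: powr_one)
    qed
    ultimately have "C0 powr ?q * m * norm x powr (\<alpha> * ?q) \<le> u x"
      using u\<xi>[OF x1] by simp
    then have "norm x powr ((N - 2) / 2 * \<alpha>) * (C0 powr ?q * m * norm x powr (\<alpha> * ?q)) \<le>
        norm x powr ((N - 2) / 2 * \<alpha>) * u x"
      by (intro mult_left_mono) auto
    moreover have "norm x powr ((N - 2) / 2 * \<alpha>) * norm x powr (\<alpha> * ?q) = 1"
      using x by (simp add: powr_add[symmetric])
    then have "norm x powr ((N - 2) / 2 * \<alpha>) * (C0 powr ?q * m * norm x powr (\<alpha> * ?q)) = C0 powr ?q * m"
      by (simp add: mult.left_commute)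
    moreover have "C0 powr ?q * m = m / C0 powr ((N - 2) / 2)"
      by (simp only: powr_minus_divide) simp
    ultimately show "norm x powr ((N - 2) / 2 * \<alpha>) * u x \<ge> m / C0 powr ((N - 2) / 2)" by argo
  qed
  moreover have "0 < (INF x\<in>ball 0 1 - {0}. ereal (u x)) \<and>
         (INF x\<in>ball 0 1 - {0}. ereal (u x)) \<le> (SUP x\<in>ball 0 1 - {0}. ereal (u x)) \<and>
         (SUP x\<in>ball 0 1 - {0}. ereal (u x)) < \<infinity> \<and>
         (\<exists>u'. (\<forall>x\<in>ball 0 1 - {0}. u' x = u x) \<and> u' \<in> holder_space \<alpha> (ball 0 1))"
    if "L \<noteq> 0"
  proof -
    have "continuous_on (ball 0 (5/4)) X"
      using holder_imp_uniformly_continuous[OF Xhol2 \<alpha>(1) K2] by (rule uniformly_continuous_imp_continuous)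
    then have "continuous_on (cball 0 1) X" by (rule continuous_on_subset) auto
    then obtain z where z: "z \<in> cball 0 1" "\<And>x. x \<in> cball 0 1 \<Longrightarrow> X z \<le> X x"
      using continuous_attains_inf[of "cball 0 1" X] by auto
    define \<mu> where "\<mu> = X z"
    have \<mu>: "0 < \<mu>" using z(1) \<xi>pos[of z] L0 that by (cases "z = 0") (auto simp: \<mu>_def X)
    have X\<mu>: "\<mu> \<le> X x" if "x \<in> ball 0 1" for x using z(2)[of x] that by (simp add: \<mu>_def)
    define V where "V x = X x powr ?q" for x
    have Vu: "V x = u x" if "x \<in> ball 0 1 - {0}" for x
      using u\<xi>[of x] that by (auto simp: V_def X)
    have VM: "0 \<le> V x" "V x \<le> \<mu> powr ?q" if "x \<in> ball 0 1" for x
      unfolding V_def using X\<mu>[OF that] \<mu> N2 by (auto intro: powr_mono2')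
    let ?K = "\<bar>?q\<bar> * \<mu> powr (?q - 1)"
    have Vh: "\<bar>V x - V y\<bar> \<le> ?K * K2 * dist x y powr \<alpha>" if xy: "x \<in> ball 0 1" "y \<in> ball 0 1" for x y
    proof -
      have "\<bar>V x - V y\<bar> \<le> ?K * \<bar>X x - X y\<bar>"
        unfolding V_def
      proof (rule powr_diff_le)
        show "0 < X x" "0 < X y" using X\<mu>[OF xy(1)] X\<mu>[OF xy(2)] \<mu> by auto
        fix s assume "min (X x) (X y) \<le> s"
        then have "\<mu> \<le> s" using X\<mu>[OF xy(1)] X\<mu>[OF xy(2)] by auto
        then have "s powr (?q - 1) \<le> \<mu> powr (?q - 1)" using \<mu> N2 by (intro powr_mono2') auto
        then show "\<bar>?q\<bar> * s powr (?q - 1) \<le> ?K" by (intro mult_left_mono) auto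
      qed
      also have "\<dots> \<le> ?K * (K2 * dist x y powr \<alpha>)"
        using Xhol2[of x y] xy by (intro mult_left_mono) auto
      finally show ?thesis by (simp add: mult.assoc)
    qed
    have "V \<in> holder_space \<alpha> (ball 0 1)"
    proof (rule holder_space_memI[OF _ Vh])
      show "\<bar>V x\<bar> \<le> \<mu> powr ?q" if "x \<in> ball 0 1" for x using VM[OF that] by simp
    qed (use K2 in auto)
    moreover have "ereal m \<le> (INF x\<in>ball 0 1 - {0}. ereal (u x))"
      using ulow by (intro INF_greatest) auto
    then have "0 < (INF x\<in>ball 0 1 - {0}. ereal (u x))"
      using m(1) by (metis ereal_less(2) less_le_trans)
    moreover have "(SUP x\<in>ball 0 1 - {0}. ereal (u x)) \<le> ereal (\<mu> powr ?q)"
      using VM(2) Vu by (intro SUP_least) force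
    then have "(SUP x\<in>ball 0 1 - {0}. ereal (u x)) < \<infinity>" by (rule le_less_trans) simp
    moreover have "(INF x\<in>ball 0 1 - {0}. ereal (u x)) \<le> (SUP x\<in>ball 0 1 - {0}. ereal (u x))"
    proof (rule INF_le_SUP)
      show "ball 0 1 - {0} \<noteq> ({} :: (real ^ 'n) set)"
        using near eventually_happens[of _ "at (0 :: real ^ 'n)"] by fastforce
    qed
    ultimately show ?thesis using Vu by blast
  qed
  ultimately show ?thesis using Xsp Xn X by blast
qed

end

theorem corollary1p4:
  assumes "CARD('n::finite) \<ge> 3"
  shows "\<exists>C>0. \<forall>(k::nat) (u :: real ^ 'n \<Rightarrow> real).
    real CARD('n) / 2 < real k \<longrightarrow> k \<le> CARD('n) \<longrightarrow>
    C2_on (ball 0 2 - {0}) u \<longrightarrow>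
    (\<forall>x\<in>ball 0 2 - {0}. u x > 0) \<longrightarrow>
    (\<forall>x\<in>ball 0 2 - {0}. \<exists>l. eigenvalue_vector (conformal_hessian u x) l \<and> l \<in> closure (Gamma_cone k)) \<longrightarrow>
    (let n = real CARD('n);
         \<alpha> = (2 * real k - n) / real k;
         \<xi> = (\<lambda>x. u x powr (- 2 / (n - 2)));
         m = (INF x\<in>sphere 0 1. u x)
     in 0 < \<alpha> \<and> \<alpha> \<le> 1 \<and>
        (\<exists>\<xi>'. (\<forall>x\<in>ball 0 1 - {0}. \<xi>' x = \<xi> x) \<and>
              \<xi>' \<in> holder_space \<alpha> (ball 0 1) \<and>
              holder_norm \<alpha> (ball 0 (1/2)) \<xi>' \<le> ennreal (C * m powr (- 2 / (n - 2)))) \<and>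
        ((0 < (INF x\<in>ball 0 1 - {0}. ereal (u x)) \<and>
         (INF x\<in>ball 0 1 - {0}. ereal (u x)) \<le> (SUP x\<in>ball 0 1 - {0}. ereal (u x)) \<and>
         (SUP x\<in>ball 0 1 - {0}. ereal (u x)) < \<infinity> \<and>
         (\<exists>u'. (\<forall>x\<in>ball 0 1 - {0}. u' x = u x) \<and> u' \<in> holder_space \<alpha> (ball 0 1)))
         \<or>
         (\<forall>x. 0 < norm x \<and> norm x < 1/2 \<longrightarrow>
              norm x powr ((n - 2) / 2 * \<alpha>) * u x \<ge> 1 / C * m)))"
proof -
  define n where "n = real CARD('n)"
  define C0 where "C0 = 1 + 4 * n"
  \<comment> \<open>The exponent \<open>n / 2\<close> dominates both \<open>1\<close> and \<open>(n - 2) / 2\<close>, the powers of \<open>C0\<close> in the two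
    estimates.\<close>
  define C where "C = C0 powr (n / 2)"
  have n: "3 \<le> n" "1 \<le> C0" using assms by (auto simp: n_def C0_def)
  have C: "0 < C" "C0 \<le> C" "C0 powr ((n - 2) / 2) \<le> C"
    using n powr_mono[of 1 "n / 2" C0] by (auto simp: C_def intro!: powr_mono)
  show ?thesis
  proof (rule exI[of _ C], intro conjI allI impI C(1))
    fix k :: nat and u :: "real ^ 'n \<Rightarrow> real"
    assume "real CARD('n) / 2 < real k" "k \<le> CARD('n)" "C2_on (ball 0 2 - {0}) u"
      "\<forall>x\<in>ball 0 2 - {0}. u x > 0"
      "\<forall>x\<in>ball 0 2 - {0}. \<exists>l. eigenvalue_vector (conformal_hessian u x) l \<and> l \<in> closure (Gamma_cone k)"
    then interpret admissible k u
      using assms by unfold_locales auto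
    have nN: "N = n" by (simp add: N_def n_def)
    define m where "m = (INF x\<in>sphere 0 1. u x)"
    have m: "0 < m" unfolding m_def by (rule sphere_minimum(1)) auto
    have ext: "ennreal (C0 * m powr (- 2 / (n - 2))) \<le> ennreal (C * m powr (- 2 / (n - 2)))"
      using C(2) by (intro ennreal_leI mult_right_mono) auto
    have low: "1 / C * m \<le> m / C0 powr ((n - 2) / 2)"
      using m C n by (auto intro!: divide_left_mono)
    note main = holder_extension_and_dichotomy[unfolded nN, folded C0_def m_def]
    show "let n = real CARD('n);
         \<alpha> = (2 * real k - n) / real k;
         \<xi> = (\<lambda>x. u x powr (- 2 / (n - 2)));
         m = (INF x\<in>sphere 0 1. u x)
     in 0 < \<alpha> \<and> \<alpha> \<le> 1 \<and>
        (\<exists>\<xi>'. (\<forall>x\<in>ball 0 1 - {0}. \<xi>' x = \<xi> x) \<and>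
              \<xi>' \<in> holder_space \<alpha> (ball 0 1) \<and>
              holder_norm \<alpha> (ball 0 (1/2)) \<xi>' \<le> ennreal (C * m powr (- 2 / (n - 2)))) \<and>
        ((0 < (INF x\<in>ball 0 1 - {0}. ereal (u x)) \<and>
         (INF x\<in>ball 0 1 - {0}. ereal (u x)) \<le> (SUP x\<in>ball 0 1 - {0}. ereal (u x)) \<and>
         (SUP x\<in>ball 0 1 - {0}. ereal (u x)) < \<infinity> \<and>
         (\<exists>u'. (\<forall>x\<in>ball 0 1 - {0}. u' x = u x) \<and> u' \<in> holder_space \<alpha> (ball 0 1)))
         \<or>
         (\<forall>x. 0 < norm x \<and> norm x < 1/2 \<longrightarrow>
              norm x powr ((n - 2) / 2 * \<alpha>) * u x \<ge> 1 / C * m))"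
      unfolding Let_def n_def[symmetric] m_def[symmetric] \<alpha>_def[symmetric, unfolded nN] \<xi>_def[symmetric, unfolded nN]
      using const_bounds(4,5) main ext low by (meson order_trans)
  qed
qed

end
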